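(* Let $X$ be a complete metric space. Then there exists a unique decomposition of $X$ as a direct product $X = Y\times H$, where the metric space $Y$ does not contain splitting lines and $H$ is a (possibly finite- or zero-dimensional) Hilbert space. For any point $x\in X$, the maximal Hilbert space factor $H_x$ (with respect to inclusion) containing $x$ coincides with the union of all splitting lines $\ell\subset X$ containing $x$.
   Context: Isometries are surjective distance-preserving maps; Hilbert spaces are real, and the zero space is allowed. For metric spaces $Y,\bar Y$, the direct product $Y\times\bar Y$ carries the metric $d((y_1,\bar y_1),(y_2,\bar y_2))=\sqrt{d(y_1,y_2)^2+d(\bar y_1,\bar y_2)^2}$. A line in a metric space $X$ is a subset isometric to $\mathbb{R}$. A line $\ell\subset X$ is a splitting line in $X$ if there exist a metric space $Y$ and an isometry $\Phi:X\to\mathbb{R}\times Y$ such that the composition of $\Phi$ with the projection $P^Y:\mathbb{R}\times Y\to Y$ sends $\ell$ to a point. A decomposition $X=Y\times\bar Y$ is an isometry $I:X\to Y\times\bar Y$; writing $P^Y,P^{\bar Y}$ for the resulting projections of $X$ to the factors, the $Y$-fiber through $x\in X$ is $Y_x:=(P^{\bar Y})^{-1}(P^{\bar Y}(x))$, and the $\bar Y$-fiber is $\bar Y_x:=(P^{Y})^{-1}(P^{Y}(x))$. Two decompositions $X=Y\times H$ and $X=Y'\times H'$ are regarded as the same if $Y_x=Y'_x$ and $H_x=H'_x$ as subsets of $X$ for every $x\in X$; uniqueness is meant in this sense. A subset $A\subset X$ containing $x$ is a factor subset if there is a decomposition $X=Y\times\bar Y$ with $A=Y_x$. A Hilbert space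 factor of $X$ containing $x$ is a factor subset containing $x$ that is isometric to a (possibly finite- or zero-dimensional) Hilbert space. The maximal Hilbert space factor containing $x$ is the maximal element, with respect to inclusion, among the Hilbert space factors containing $x$; it is the $H$-fiber $H_x$ through $x$ of the decomposition $X=Y\times H$ in the claim.
   Formalization: The union of all splitting lines containing x is taken together with the point x itself, since when H is zero-dimensional (e.g. X a single point) there are no splitting lines while H_x = {x}; otherwise it is the plain union. *)

theory Defs
  imports "HOL-Analysis.Abstract_Metric_Spaces" "HOL-Algebra.Module"
begin

section \<open>Isometries and lines\<close>

definition isometry :: "'a metric \<Rightarrow> 'b metric \<Rightarrow> ('a \<Rightarrow> 'b) \<Rightarrow> bool" where
  "isometry M N f \<longleftrightarrow> f ` mspace M = mspace N \<and>
     (\<forall>x\<in>mspace M. \<forall>y\<in>mspace M. mdist N (f x) (f y) = mdist M x y)"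

definition isometric :: "'a metric \<Rightarrow> 'b metric \<Rightarrow> bool" where
  "isometric M N \<longleftrightarrow> (\<exists>f. isometry M N f)"

definition line_in :: "'a metric \<Rightarrow> 'a set \<Rightarrow> bool" where
  "line_in X l \<longleftrightarrow> l \<subseteq> mspace X \<and> isometric (submetric X l) (euclidean_metric :: real metric)"

text \<open>The complementary factor \<open>Y\<close> is taken over the element type of \<open>X\<close>, as HOL cannot
  quantify over types. This loses no generality: a factor of a nonempty space is isometric to a
  fiber, hence to a subset of \<open>X\<close> (lemma \<open>splitting_lineI\<close> below).\<close>

definition splitting_line :: "'a metric \<Rightarrow> 'a set \<Rightarrow> bool" where
  "splitting_line X l \<longleftrightarrow> line_in X l \<and>
     (\<exists>(Y :: 'a metric) \<Phi>. isometry X (prod_metric (euclidean_metric :: real metric) Y) \<Phi> \<and>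
        (\<exists>y\<in>mspace Y. \<forall>p\<in>l. snd (\<Phi> p) = y))"

section \<open>Decompositions\<close>

definition decomposition :: "'a metric \<Rightarrow> 'b metric \<Rightarrow> 'c metric \<Rightarrow> ('a \<Rightarrow> 'b \<times> 'c) \<Rightarrow> bool" where
  "decomposition X Y Z I \<longleftrightarrow> isometry X (prod_metric Y Z) I"

text \<open>For a decomposition \<open>X = Y \<times> Z\<close>, the \<open>Y\<close>-fiber through \<open>x\<close> is the level set of the
  projection to \<open>Z\<close>, and vice versa.\<close>

definition fst_fiber :: "'a metric \<Rightarrow> ('a \<Rightarrow> 'b \<times> 'c) \<Rightarrow> 'a \<Rightarrow> 'a set" where
  "fst_fiber X I x = {p \<in> mspace X. snd (I p) = snd (I x)}"

definition snd_fiber :: "'a metric \<Rightarrow> ('a \<Rightarrow> 'b \<times> 'c) \<Rightarrow> 'a \<Rightarrow> 'a set" where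
  "snd_fiber X I x = {p \<in> mspace X. fst (I p) = fst (I x)}"

definition same_decomposition ::
    "'a metric \<Rightarrow> ('a \<Rightarrow> 'b \<times> 'c) \<Rightarrow> ('a \<Rightarrow> 'd \<times> 'e) \<Rightarrow> bool" where
  "same_decomposition X I J \<longleftrightarrow>
     (\<forall>x\<in>mspace X. fst_fiber X I x = fst_fiber X J x \<and> snd_fiber X I x = snd_fiber X J x)"

text \<open>As for splitting lines, both factors may be taken over the element type of \<open>X\<close>
  (lemmas \<open>factor_subsetI\<close> and \<open>hilbert_factorI\<close> below).\<close>

definition factor_subset :: "'a metric \<Rightarrow> 'a \<Rightarrow> 'a set \<Rightarrow> bool" where
  "factor_subset X x A \<longleftrightarrow> x \<in> mspace X \<and>
     (\<exists>(Y :: 'a metric) (Z :: 'a metric) I. decomposition X Y Z I \<and> A = fst_fiber X I x)"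

section \<open>Hilbert spaces\<close>

definition real_ring :: "real ring" where
  "real_ring = \<lparr>carrier = UNIV, monoid.mult = (*), one = 1, ring.zero = 0, add = (+)\<rparr>"

locale real_inner_product_space = module real_ring V
  for V :: "(real, 'a) module" (structure) +
  fixes ip :: "'a \<Rightarrow> 'a \<Rightarrow> real"
  assumes ip_commute: "\<lbrakk>u \<in> carrier V; v \<in> carrier V\<rbrakk> \<Longrightarrow> ip u v = ip v u"
    and ip_add_left: "\<lbrakk>u \<in> carrier V; v \<in> carrier V; w \<in> carrier V\<rbrakk>
          \<Longrightarrow> ip (u \<oplus>\<^bsub>V\<^esub> v) w = ip u w + ip v w"
    and ip_smult_left: "\<lbrakk>u \<in> carrier V; v \<in> carrier V\<rbrakk> \<Longrightarrow> ip (c \<odot>\<^bsub>V\<^esub> u) v = c * ip u v"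
    and ip_nonneg: "u \<in> carrier V \<Longrightarrow> 0 \<le> ip u u"
    and ip_eq_zero: "\<lbrakk>u \<in> carrier V; ip u u = 0\<rbrakk> \<Longrightarrow> u = \<zero>\<^bsub>V\<^esub>"

text \<open>A metric space is a Hilbert space if it is complete and its metric comes from a real
  inner product space structure on its underlying set. There is no restriction on the dimension;
  the empty space is excluded, since the carrier contains zero.\<close>

definition hilbert_space :: "'a metric \<Rightarrow> bool" where
  "hilbert_space H \<longleftrightarrow> mcomplete_of H \<and>
     (\<exists>V ip. real_inner_product_space V ip \<and> carrier V = mspace H \<and>
        (\<forall>u\<in>mspace H. \<forall>v\<in>mspace H. mdist H u v = sqrt (ip (u \<ominus>\<^bsub>V\<^esub> v) (u \<ominus>\<^bsub>V\<^esub> v))))"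

definition hilbert_factor :: "'a metric \<Rightarrow> 'a \<Rightarrow> 'a set \<Rightarrow> bool" where
  "hilbert_factor X x A \<longleftrightarrow> factor_subset X x A \<and>
     (\<exists>H :: 'a metric. hilbert_space H \<and> isometric (submetric X A) H)"

text \<open>``The'' maximal element is read as the greatest one; in particular it is the unique
  maximal element.\<close>

definition is_maximal_hilbert_factor :: "'a metric \<Rightarrow> 'a \<Rightarrow> 'a set \<Rightarrow> bool" where
  "is_maximal_hilbert_factor X x A \<longleftrightarrow>
     hilbert_factor X x A \<and> (\<forall>B. hilbert_factor X x B \<longrightarrow> B \<subseteq> A)"

text \<open>Convention on ``the union of all splitting lines containing \<open>x\<close>'': if the Hilbert factor is
  zero-dimensional, there are no splitting lines, while the fiber through \<open>x\<close> is \<open>{x}\<close>. The union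
  is therefore understood to contain \<open>x\<close>, i.e. as
  \<open>insert x (\<Union>{l. splitting_line X l \<and> x \<in> l})\<close>; as soon as one splitting line passes through
  \<open>x\<close>, this is the plain union.\<close>

section \<open>Factors over arbitrary types\<close>

lemma isometry_inj_on: "isometry M N f \<Longrightarrow> inj_on f (mspace M)"
  unfolding isometry_def inj_on_def by (metis mdist_zero)

lemma decomposition_transfer:
  fixes X :: "'a metric" and Y :: "'b metric" and Z :: "'c metric"
  assumes D: "decomposition X Y Z I" and x: "x \<in> mspace X"
  obtains J :: "'a \<Rightarrow> 'a \<times> 'a"
  where "decomposition X (submetric X (fst_fiber X I x)) (submetric X (snd_fiber X I x)) J"
    and "same_decomposition X I J"
proof -
  have im: "I ` mspace X = mspace Y \<times> mspace Z"
    and d: "\<And>p q. \<lbrakk>p \<in> mspace X; q \<in> mspace X\<rbrakk> \<Longrightarrow>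
      mdist X p q = sqrt (mdist Y (fst (I p)) (fst (I q)) ^ 2 + mdist Z (snd (I p)) (snd (I q)) ^ 2)"
    using D by (auto simp: decomposition_def isometry_def prod_dist_def case_prod_unfold)
  have inj: "\<And>p q. \<lbrakk>p \<in> mspace X; q \<in> mspace X; I p = I q\<rbrakk> \<Longrightarrow> p = q"
    using D isometry_inj_on[of X _ I] unfolding decomposition_def inj_on_def by blast
  have mem: "fst (I p) \<in> mspace Y" "snd (I p) \<in> mspace Z" if "p \<in> mspace X" for p
    using im that by (metis imageI mem_Times_iff)+
  define K where "K = inv_into (mspace X) I"
  have K: "K (y, z) \<in> mspace X" "I (K (y, z)) = (y, z)" if "y \<in> mspace Y" "z \<in> mspace Z" for y z
    using that im unfolding K_def by (auto intro!: inv_into_into f_inv_into_f)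
  define J where "J = (\<lambda>p. (K (fst (I p), snd (I x)), K (fst (I x), snd (I p))))"
  have J: "fst (J p) \<in> fst_fiber X I x" "snd (J p) \<in> snd_fiber X I x"
      "I (fst (J p)) = (fst (I p), snd (I x))" "I (snd (J p)) = (fst (I x), snd (I p))"
    if "p \<in> mspace X" for p
    using K mem that x by (auto simp: J_def fst_fiber_def snd_fiber_def)
  have sub: "fst_fiber X I x \<subseteq> mspace X" "snd_fiber X I x \<subseteq> mspace X"
    by (auto simp: fst_fiber_def snd_fiber_def)
  have imJ: "J ` mspace X = fst_fiber X I x \<times> snd_fiber X I x"
  proof
    show "J ` mspace X \<subseteq> fst_fiber X I x \<times> snd_fiber X I x"
    proof clarify
      fix a b p assume ab: "(a, b) = J p" and p: "p \<in> mspace X"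
      show "a \<in> fst_fiber X I x \<and> b \<in> snd_fiber X I x"
        using J(1,2)[OF p] unfolding ab[symmetric] by simp
    qed
    show "fst_fiber X I x \<times> snd_fiber X I x \<subseteq> J ` mspace X"
    proof clarify
      fix a b assume a: "a \<in> fst_fiber X I x" and b: "b \<in> snd_fiber X I x"
      define p where "p = K (fst (I a), snd (I b))"
      have p: "p \<in> mspace X" "I p = (fst (I a), snd (I b))"
        unfolding p_def using K[OF mem(1)[of a] mem(2)[of b]] a b sub by (auto simp: subset_iff)
      have "I (fst (J p)) = I a" "I (snd (J p)) = I b"
        using J[OF p(1)] p a b by (auto simp: fst_fiber_def snd_fiber_def prod_eq_iff)
      moreover have "fst (J p) \<in> mspace X" "a \<in> mspace X" "snd (J p) \<in> mspace X" "b \<in> mspace X"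
        using J(1,2)[OF p(1)] a b sub by blast+
      ultimately have "J p = (a, b)"
        using inj by (simp add: prod_eq_iff)
      then show "(a, b) \<in> J ` mspace X" using p(1) by force
    qed
  qed
  have dJ: "sqrt (mdist X (fst (J p)) (fst (J q)) ^ 2 + mdist X (snd (J p)) (snd (J q)) ^ 2) = mdist X p q"
    if p: "p \<in> mspace X" and q: "q \<in> mspace X" for p q
  proof -
    have z: "mdist Y (fst (I x)) (fst (I x)) = 0" "mdist Z (snd (I x)) (snd (I x)) = 0"
      using mem[OF x] by simp_all
    have "mdist X (fst (J p)) (fst (J q)) = mdist Y (fst (I p)) (fst (I q))"
      using d[of "fst (J p)" "fst (J q)"] J[OF p] J[OF q] sub z by (auto simp: subset_iff)
    moreover have "mdist X (snd (J p)) (snd (J q)) = mdist Z (snd (I p)) (snd (I q))"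
      using d[of "snd (J p)" "snd (J q)"] J[OF p] J[OF q] sub z by (auto simp: subset_iff)
    ultimately show ?thesis using d[OF p q] by simp
  qed
  have dec: "decomposition X (submetric X (fst_fiber X I x)) (submetric X (snd_fiber X I x)) J"
    using sub by (simp add: decomposition_def isometry_def prod_dist_def case_prod_unfold
        Int_absorb2 imJ dJ)
  have eq: "fst (J p) = fst (J q) \<longleftrightarrow> fst (I p) = fst (I q)"
    "snd (J p) = snd (J q) \<longleftrightarrow> snd (I p) = snd (I q)"
    if "p \<in> mspace X" "q \<in> mspace X" for p q
  proof -
    show "fst (J p) = fst (J q) \<longleftrightarrow> fst (I p) = fst (I q)"
      using J(3)[OF that(1)] J(3)[OF that(2)] by (metis J_def fst_conv)
    show "snd (J p) = snd (J q) \<longleftrightarrow> snd (I p) = snd (I q)"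
      using J(4)[OF that(1)] J(4)[OF that(2)] by (metis J_def snd_conv)
  qed
  have "same_decomposition X I J"
    using eq by (auto simp: same_decomposition_def fst_fiber_def snd_fiber_def)
  with dec show ?thesis by (rule that)
qed

lemma factor_subsetI:
  fixes X :: "'a metric" and Y :: "'b metric" and Z :: "'c metric"
  assumes "decomposition X Y Z I" and "x \<in> mspace X"
  shows "factor_subset X x (fst_fiber X I x)"
proof -
  obtain J :: "'a \<Rightarrow> 'a \<times> 'a"
    where "decomposition X (submetric X (fst_fiber X I x)) (submetric X (snd_fiber X I x)) J"
      and "same_decomposition X I J"
    using assms by (rule decomposition_transfer)
  then show ?thesis
    using assms(2) unfolding factor_subset_def same_decomposition_def by blast
qed

lemma splitting_lineI:
  fixes X :: "'a metric" and Y :: "'b metric"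
  assumes l: "line_in X l"
    and \<Phi>: "isometry X (prod_metric (euclidean_metric :: real metric) Y) \<Phi>"
    and y: "\<forall>p\<in>l. snd (\<Phi> p) = y"
  shows "splitting_line X l"
proof -
  have lX: "l \<subseteq> mspace X" using l by (simp add: line_in_def)
  have "l \<noteq> {}" using l by (auto simp: line_in_def isometric_def isometry_def)
  then obtain x where x: "x \<in> l" "x \<in> mspace X" using lX by blast
  obtain J :: "'a \<Rightarrow> 'a \<times> 'a"
    where J: "decomposition X (submetric X (fst_fiber X \<Phi> x)) (submetric X (snd_fiber X \<Phi> x)) J"
      and same: "same_decomposition X \<Phi> J"
    using \<Phi>[folded decomposition_def] x(2) by (rule decomposition_transfer)
  have im: "\<Phi> ` mspace X = UNIV \<times> mspace Y"
    and d: "\<And>p q. \<lbrakk>p \<in> mspace X; q \<in> mspace X\<rbrakk> \<Longrightarrow>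
      mdist X p q = sqrt (dist (fst (\<Phi> p)) (fst (\<Phi> q)) ^ 2 + mdist Y (snd (\<Phi> p)) (snd (\<Phi> q)) ^ 2)"
    using \<Phi> by (auto simp: isometry_def prod_dist_def case_prod_unfold)
  define A where "A = fst_fiber X \<Phi> x"
  define B where "B = snd_fiber X \<Phi> x"
  have sub: "A \<subseteq> mspace X" "B \<subseteq> mspace X" by (auto simp: A_def B_def fst_fiber_def snd_fiber_def)
  have snd_x: "snd (\<Phi> x) \<in> mspace Y" using im x by (metis imageI mem_Times_iff)
  have J1: "J ` mspace X = A \<times> B" using J sub
    by (simp add: decomposition_def isometry_def A_def B_def Int_absorb2)
  have J2: "mdist X p q = sqrt (mdist X (fst (J p)) (fst (J q)) ^ 2 + mdist X (snd (J p)) (snd (J q)) ^ 2)"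
    if "p \<in> mspace X" "q \<in> mspace X" for p q
    using J sub that by (simp add: decomposition_def isometry_def prod_dist_def case_prod_unfold)
  define \<Psi> where "\<Psi> = (\<lambda>p. (fst (\<Phi> (fst (J p))), snd (J p)))"
  have fA: "(\<lambda>a. fst (\<Phi> a)) ` A = UNIV"
  proof -
    have "t \<in> (\<lambda>a. fst (\<Phi> a)) ` A" for t
    proof -
      obtain a where "a \<in> mspace X" "\<Phi> a = (t, snd (\<Phi> x))"
        using im snd_x by (metis (no_types, lifting) SigmaI UNIV_I imageE)
      then show ?thesis by (auto simp: A_def fst_fiber_def image_iff intro!: bexI[of _ a])
    qed
    then show ?thesis by blast
  qed
  have "\<Psi> ` mspace X = (\<lambda>(a, b). (fst (\<Phi> a), b)) ` (A \<times> B)"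
    unfolding J1[symmetric] image_image by (simp add: \<Psi>_def case_prod_unfold)
  also have "\<dots> = UNIV \<times> B" using fA by (fastforce simp: image_iff)
  finally have im': "\<Psi> ` mspace X = UNIV \<times> B" .
  have "dist (fst (\<Phi> a)) (fst (\<Phi> a')) = mdist X a a'" if "a \<in> A" "a' \<in> A" for a a'
  proof -
    have "mdist Y (snd (\<Phi> x)) (snd (\<Phi> x)) = 0" using snd_x by simp
    then show ?thesis using that d[of a a'] by (auto simp: A_def fst_fiber_def simp del: mdist_zero)
  qed
  moreover have "fst (J p) \<in> A" if "p \<in> mspace X" for p
    using J1 that by (metis imageI mem_Times_iff)
  ultimately have "isometry X (prod_metric (euclidean_metric :: real metric) (submetric X B)) \<Psi>"
    using im' J2 sub
    by (auto simp: isometry_def prod_dist_def case_prod_unfold Int_absorb2 \<Psi>_def)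
  moreover have "snd (J x) \<in> mspace (submetric X B)"
    using J1 x sub by (simp add: Int_absorb2) (metis imageI mem_Times_iff)
  moreover have "\<forall>p\<in>l. snd (\<Psi> p) = snd (J x)"
  proof
    fix p assume "p \<in> l"
    then have "p \<in> fst_fiber X \<Phi> x" using y x lX by (auto simp: fst_fiber_def)
    then have "p \<in> fst_fiber X J x" using same x by (simp add: same_decomposition_def)
    then show "snd (\<Psi> p) = snd (J x)" by (simp add: fst_fiber_def \<Psi>_def)
  qed
  ultimately show ?thesis using l unfolding splitting_line_def by blast
qed

lemma hilbert_space_isometric:
  fixes M :: "'a metric" and N :: "'b metric"
  assumes "isometric M N" and H: "hilbert_space N"
  shows "hilbert_space M"
proof -
  obtain f where iso: "isometry M N f" using assms(1) by (auto simp: isometric_def)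
  have im: "f ` mspace M = mspace N"
    and d: "\<And>x y. \<lbrakk>x \<in> mspace M; y \<in> mspace M\<rbrakk> \<Longrightarrow> mdist N (f x) (f y) = mdist M x y"
    using iso by (auto simp: isometry_def)
  have f: "f x \<in> mspace N" if "x \<in> mspace M" for x using im that by blast
  obtain V ip where V: "real_inner_product_space V ip" and car: "carrier V = mspace N"
    and dV: "\<And>u v. \<lbrakk>u \<in> mspace N; v \<in> mspace N\<rbrakk> \<Longrightarrow>
      mdist N u v = sqrt (ip (u \<ominus>\<^bsub>V\<^esub> v) (u \<ominus>\<^bsub>V\<^esub> v))"
    and comp: "mcomplete_of N"
    using H by (auto simp: hilbert_space_def)
  interpret V: real_inner_product_space V ip by (rule V)
  define g where "g = inv_into (mspace M) f"
  have g: "g y \<in> mspace M" "f (g y) = y" if "y \<in> mspace N" for y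
    using that im by (auto simp: g_def inv_into_into f_inv_into_f)
  have gf: "g (f x) = x" if "x \<in> mspace M" for x
    using isometry_inj_on[OF iso] that by (simp add: g_def)
  define W :: "(real, 'a) module" where
    "W = \<lparr>carrier = mspace M, monoid.mult = undefined, one = undefined, ring.zero = g \<zero>\<^bsub>V\<^esub>,
          add = (\<lambda>u v. g (f u \<oplus>\<^bsub>V\<^esub> f v)), smult = (\<lambda>c u. g (c \<odot>\<^bsub>V\<^esub> f u))\<rparr>"
  have clV: "\<And>u v. \<lbrakk>u \<in> mspace N; v \<in> mspace N\<rbrakk> \<Longrightarrow> u \<oplus>\<^bsub>V\<^esub> v \<in> mspace N"
      "\<And>c u. u \<in> mspace N \<Longrightarrow> c \<odot>\<^bsub>V\<^esub> u \<in> mspace N" "\<zero>\<^bsub>V\<^esub> \<in> mspace N"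
    using V.M.a_closed V.smult_closed V.M.zero_closed by (auto simp: car real_ring_def)
  have W: "carrier W = mspace M" "\<zero>\<^bsub>W\<^esub> = g \<zero>\<^bsub>V\<^esub>"
      "\<And>u v. u \<oplus>\<^bsub>W\<^esub> v = g (f u \<oplus>\<^bsub>V\<^esub> f v)" "\<And>c u. c \<odot>\<^bsub>W\<^esub> u = g (c \<odot>\<^bsub>V\<^esub> f u)"
    by (simp_all add: W_def)
  note Vax = V.M.a_assoc[unfolded car] V.M.a_lcomm[unfolded car] V.M.a_comm[unfolded car] V.M.l_zero[unfolded car]
  have ab: "abelian_group W"
  proof (rule abelian_groupI, unfold W)
    fix x assume x: "x \<in> mspace M"
    have "g (\<ominus>\<^bsub>V\<^esub> f x) \<in> mspace M" "g (f (g (\<ominus>\<^bsub>V\<^esub> f x)) \<oplus>\<^bsub>V\<^esub> f x) = g \<zero>\<^bsub>V\<^esub>"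
      using V.M.a_inv_closed[unfolded car] V.M.l_neg[unfolded car] f[OF x] g by simp_all
    then show "\<exists>y\<in>mspace M. g (f y \<oplus>\<^bsub>V\<^esub> f x) = g \<zero>\<^bsub>V\<^esub>" by blast
  qed (use f g gf clV in \<open>simp_all add: Vax\<close>)
  interpret W: abelian_group W by (rule ab)
  have fadd: "f (u \<oplus>\<^bsub>W\<^esub> v) = f u \<oplus>\<^bsub>V\<^esub> f v" if "u \<in> mspace M" "v \<in> mspace M" for u v
    using that f g clV by (simp add: W)
  have fsm: "f (c \<odot>\<^bsub>W\<^esub> u) = c \<odot>\<^bsub>V\<^esub> f u" if "u \<in> mspace M" for c u
    using that f g clV by (simp add: W)
  have fminus: "f (u \<ominus>\<^bsub>W\<^esub> v) = f u \<ominus>\<^bsub>V\<^esub> f v" if u: "u \<in> mspace M" and v: "v \<in> mspace M" for u v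
  proof -
    have m: "\<ominus>\<^bsub>W\<^esub> v \<in> mspace M" using W.a_inv_closed v by (simp add: W)
    have "f (\<ominus>\<^bsub>W\<^esub> v) \<oplus>\<^bsub>V\<^esub> f v = \<zero>\<^bsub>V\<^esub>"
      using fadd[OF m v] W.l_neg[of v] v g clV by (simp add: W(1,2))
    then have "f (\<ominus>\<^bsub>W\<^esub> v) = \<ominus>\<^bsub>V\<^esub> f v"
      using V.M.minus_equality[of "f (\<ominus>\<^bsub>W\<^esub> v)" "f v"] f m v by (simp add: car)
    then show ?thesis using fadd[OF u m] by (simp add: a_minus_def)
  qed
  have mem_W: "u \<oplus>\<^bsub>W\<^esub> v \<in> mspace M" "c \<odot>\<^bsub>W\<^esub> u \<in> mspace M" "u \<ominus>\<^bsub>W\<^esub> v \<in> mspace M"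
    if "u \<in> mspace M" "v \<in> mspace M" for c u v
    using that f g clV W.minus_closed[unfolded W(1)] by (simp_all add: W(3,4))
  have rr: "carrier real_ring = UNIV" "\<And>a b. a \<oplus>\<^bsub>real_ring\<^esub> b = a + b"
      "\<And>a b. a \<otimes>\<^bsub>real_ring\<^esub> b = a * b" "\<one>\<^bsub>real_ring\<^esub> = 1"
    by (simp_all add: real_ring_def)
  note Vsm = V.smult_l_distr[unfolded car rr, simplified] V.smult_r_distr[unfolded car rr, simplified]
    V.smult_assoc1[unfolded car rr, simplified] V.smult_one[unfolded car rr]
  have "module real_ring W"
    by (rule moduleI[OF V.R.is_cring ab]; unfold W rr; use f g gf clV Vsm in simp)
  moreover have "real_inner_product_space_axioms W (\<lambda>u v. ip (f u) (f v))"
  proof (unfold_locales, goal_cases)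
    case (5 u)
    then have "f u = \<zero>\<^bsub>V\<^esub>" using V.ip_eq_zero f by (simp add: W car)
    then show ?case using gf[of u] 5 by (simp add: W)
  qed (use f V.ip_commute V.ip_add_left V.ip_smult_left V.ip_nonneg in
      \<open>simp_all add: W(1) fadd fsm car\<close>)
  ultimately have "real_inner_product_space W (\<lambda>u v. ip (f u) (f v))"
    by (simp add: real_inner_product_space_def)
  moreover have "mdist M u v = sqrt (ip (f (u \<ominus>\<^bsub>W\<^esub> v)) (f (u \<ominus>\<^bsub>W\<^esub> v)))"
    if "u \<in> mspace M" "v \<in> mspace M" for u v
    using that d dV f by (simp add: fminus flip: d)
  moreover have "mcomplete_of M"
    unfolding mcomplete_of_def Metric_space.mcomplete_def[OF Metric_space_mspace_mdist]
  proof (intro allI impI)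
    fix \<sigma> assume "Metric_space.MCauchy (mspace M) (mdist M) \<sigma>"
    then have \<sigma>: "range \<sigma> \<subseteq> mspace M"
      and C: "\<And>\<epsilon>. \<epsilon> > 0 \<Longrightarrow> \<exists>K. \<forall>n n'. K \<le> n \<longrightarrow> K \<le> n' \<longrightarrow> mdist M (\<sigma> n) (\<sigma> n') < \<epsilon>"
      by (auto simp: Metric_space.MCauchy_def[OF Metric_space_mspace_mdist])
    have mem: "\<sigma> n \<in> mspace M" for n using \<sigma> by blast
    have "Metric_space.MCauchy (mspace N) (mdist N) (f \<circ> \<sigma>)"
      using f mem C by (auto simp: Metric_space.MCauchy_def[OF Metric_space_mspace_mdist] d)
    then obtain y where y: "limitin (mtopology_of N) (f \<circ> \<sigma>) y sequentially"
      using comp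
      by (auto simp: mcomplete_of_def mtopology_of_def Metric_space.mcomplete_def[OF Metric_space_mspace_mdist])
    then have yN: "y \<in> mspace N"
      and lim: "\<forall>\<epsilon>>0. \<exists>K. \<forall>n\<ge>K. f (\<sigma> n) \<in> mspace N \<and> mdist N (f (\<sigma> n)) y < \<epsilon>"
      by (auto simp: mtopology_of_def Metric_space.limit_metric_sequentially[OF Metric_space_mspace_mdist])
    have "mdist M (\<sigma> n) (g y) = mdist N (f (\<sigma> n)) y" for n
      using d[of "\<sigma> n" "g y"] g[OF yN] mem by simp
    then show "\<exists>x. limitin (Metric_space.mtopology (mspace M) (mdist M)) \<sigma> x sequentially"
      using lim g(1)[OF yN] mem f
      by (auto simp: Metric_space.limit_metric_sequentially[OF Metric_space_mspace_mdist]
          intro!: exI[of _ "g y"])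
  qed
  ultimately show ?thesis
    unfolding hilbert_space_def using W(1)
    by (intro conjI exI[of _ W] exI[of _ "\<lambda>u v. ip (f u) (f v)"]) auto
qed

lemma hilbert_factorI:
  fixes X :: "'a metric" and H :: "'b metric"
  assumes "factor_subset X x A" and "isometric (submetric X A) H" and "hilbert_space H"
  shows "hilbert_factor X x A"
proof -
  have "hilbert_space (submetric X A)" using assms(2,3) by (rule hilbert_space_isometric)
  moreover have "isometric (submetric X A) (submetric X A)"
    unfolding isometric_def isometry_def by (rule exI[of _ id]) simp
  ultimately show ?thesis using assms(1) unfolding hilbert_factor_def by blast
qed

end

(* A splitting X = R x Y is the same as a flow by isometries for which the squared distance
   d(p, phi_t q)^2 is a quadratic polynomial in t whose linear coefficient is -2 (b p - b q) for a
   height function b. Comparing the two orders in which two such flows can be applied shows that b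
   grows along the other flow with a constant slope, so the flows can be composed, and the normalized
   height functions form a real inner product space V with the slope as inner product. Completeness
   of X makes V a Hilbert space, which acts on X by translations. By the Riesz representation of
   v |-> v p, the space X is the product of an orbit of V and the common zero set of V. Conversely, for
   any decomposition X = Y x H as in the theorem, H consists of translations in V, and a translation
   orthogonal to those coming from H acts on Y, so that it is trivial. *)

theory Submission
  imports Defs
begin

text \<open>A general metric space has no geodesics and no linear structure, so everything must be
  read off from distances. A polynomial identity for squared distances suits this: it survives
  composition, rescaling and limits, and it already forces uniqueness and the group law. Heights are
  determined only up to a constant, which is why a base point enters. Completeness supplies limits
  of orbit sequences; the delicate point is that such a limit is again the image of the base point
  under a translation of the whole space. Uniqueness follows because both fibers through
  \<open>x\<close> can be described by \<open>V\<close> alone, as the orbit of \<open>x\<close> and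
  as the common level set of \<open>V\<close> through \<open>x\<close>.\<close>

section \<open>Sequential completeness and product metrics\<close>

lemma mdist_tendsto:
  assumes "p \<in> mspace X" "y \<in> mspace X" "\<And>k::nat. \<sigma> k \<in> mspace X"
    and lim: "(\<lambda>k. mdist X (\<sigma> k) y) \<longlonglongrightarrow> 0"
  shows "(\<lambda>k. mdist X p (\<sigma> k)) \<longlonglongrightarrow> mdist X p y"
proof -
  have "\<bar>mdist X p (\<sigma> k) - mdist X p y\<bar> \<le> mdist X (\<sigma> k) y" for k
    using mdist_triangle[of p X "\<sigma> k" y] mdist_triangle[of p X y "\<sigma> k"] assms(1-3)
    by (auto simp: mdist_commute[of X y])
  then have "(\<lambda>k. mdist X p (\<sigma> k) - mdist X p y) \<longlonglongrightarrow> 0"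
    by (intro Lim_null_comparison[OF _ lim] always_eventually allI) simp
  then show ?thesis by (simp add: LIM_zero_iff)
qed

lemma mcomplete_ofE:
  assumes "mcomplete_of X" "\<And>k::nat. \<sigma> k \<in> mspace X"
    and "\<And>\<epsilon>. \<epsilon> > 0 \<Longrightarrow> \<exists>K. \<forall>m\<ge>K. \<forall>n\<ge>K. mdist X (\<sigma> m) (\<sigma> n) < \<epsilon>"
  obtains y where "y \<in> mspace X" "(\<lambda>k. mdist X (\<sigma> k) y) \<longlonglongrightarrow> 0"
proof -
  interpret M: Metric_space "mspace X" "mdist X" by (rule Metric_space_mspace_mdist)
  have "M.MCauchy \<sigma>"
    using assms(2,3) by (auto simp: M.MCauchy_def)
  then obtain y where "limitin M.mtopology \<sigma> y sequentially"
    using assms(1) by (auto simp: mcomplete_of_def M.mcomplete_def)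
  then have "y \<in> mspace X" "(\<lambda>k. mdist X (\<sigma> k) y) \<longlonglongrightarrow> 0"
    by (auto simp: M.limitin_metric_dist_null)
  then show thesis by (rule that)
qed

lemma mcomplete_ofI:
  assumes "\<And>\<sigma>::nat\<Rightarrow>'a. (\<And>k. \<sigma> k \<in> mspace X) \<Longrightarrow>
      (\<And>\<epsilon>. \<epsilon> > 0 \<Longrightarrow> \<exists>K. \<forall>m\<ge>K. \<forall>n\<ge>K. mdist X (\<sigma> m) (\<sigma> n) < \<epsilon>) \<Longrightarrow>
      \<exists>y\<in>mspace X. (\<lambda>k. mdist X (\<sigma> k) y) \<longlonglongrightarrow> 0"
  shows "mcomplete_of X"
proof -
  interpret M: Metric_space "mspace X" "mdist X" by (rule Metric_space_mspace_mdist)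
  show ?thesis
    unfolding mcomplete_of_def M.mcomplete_def
  proof (intro allI impI)
    fix \<sigma> assume C: "M.MCauchy \<sigma>"
    then have mem: "\<sigma> k \<in> mspace X" for k by (auto simp: M.MCauchy_def)
    obtain y where "y \<in> mspace X" "(\<lambda>k. mdist X (\<sigma> k) y) \<longlonglongrightarrow> 0"
      using assms[of \<sigma>] mem C by (force simp: M.MCauchy_def)
    then show "\<exists>y. limitin M.mtopology \<sigma> y sequentially"
      using mem by (auto simp: M.limitin_metric_dist_null)
  qed
qed

lemma isometry_inv_into:
  assumes "isometry M N f"
  shows "isometry N M (inv_into (mspace M) f)"
proof -
  have im: "f ` mspace M = mspace N" using assms by (simp add: isometry_def)
  have g: "inv_into (mspace M) f y \<in> mspace M" "f (inv_into (mspace M) f y) = y"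
    if "y \<in> mspace N" for y
    using that im by (auto simp: inv_into_into f_inv_into_f)
  have "inv_into (mspace M) f ` mspace N = mspace M"
    using isometry_inj_on[OF assms] im by (metis inv_into_image_cancel order_refl)
  then show ?thesis
    using assms g by (auto simp: isometry_def) metis
qed

text \<open>Distances are nonnegative, so the square root can be removed; in this Pythagorean form
  all later verifications are polynomial arithmetic.\<close>

lemma isometry_prod_iff:
  "isometry X (prod_metric Y Z) I \<longleftrightarrow> I ` mspace X = mspace Y \<times> mspace Z \<and>
     (\<forall>p\<in>mspace X. \<forall>q\<in>mspace X. (mdist X p q)\<^sup>2 =
        (mdist Y (fst (I p)) (fst (I q)))\<^sup>2 + (mdist Z (snd (I p)) (snd (I q)))\<^sup>2)"
proof -
  have "sqrt (a\<^sup>2 + b\<^sup>2) = c \<longleftrightarrow> c\<^sup>2 = a\<^sup>2 + b\<^sup>2" if "c \<ge> 0" for a b c :: real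
    using that by (auto intro: real_sqrt_unique)
  then show ?thesis
    by (simp add: isometry_def prod_dist_def case_prod_unfold)
qed

lemma decomposition_swap:
  assumes "decomposition X Y Z I"
  shows "decomposition X Z Y (\<lambda>p. prod.swap (I p))"
proof -
  have "(\<lambda>p. prod.swap (I p)) ` mspace X = prod.swap ` I ` mspace X"
    by (simp add: image_image)
  then show ?thesis
    using assms unfolding decomposition_def isometry_prod_iff by (simp add: product_swap add.commute)
qed

lemma decompositionE:
  assumes "decomposition X Y Z I"
  obtains K where "\<And>y z. y \<in> mspace Y \<Longrightarrow> z \<in> mspace Z \<Longrightarrow> K (y, z) \<in> mspace X"
    and "\<And>y z. y \<in> mspace Y \<Longrightarrow> z \<in> mspace Z \<Longrightarrow> I (K (y, z)) = (y, z)"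
    and "\<And>p. p \<in> mspace X \<Longrightarrow> K (I p) = p"
    and "\<And>p. p \<in> mspace X \<Longrightarrow> fst (I p) \<in> mspace Y"
    and "\<And>p. p \<in> mspace X \<Longrightarrow> snd (I p) \<in> mspace Z"
    and "\<And>p q. p \<in> mspace X \<Longrightarrow> q \<in> mspace X \<Longrightarrow> (mdist X p q)\<^sup>2 =
        (mdist Y (fst (I p)) (fst (I q)))\<^sup>2 + (mdist Z (snd (I p)) (snd (I q)))\<^sup>2"
proof
  let ?K = "inv_into (mspace X) I"
  have im: "I ` mspace X = mspace Y \<times> mspace Z" and inj: "inj_on I (mspace X)"
    using assms isometry_inj_on[of X "prod_metric Y Z" I]
    by (simp_all add: decomposition_def isometry_def)
  show "?K (y, z) \<in> mspace X" "I (?K (y, z)) = (y, z)" if "y \<in> mspace Y" "z \<in> mspace Z" for y z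
    using that im by (auto intro!: inv_into_into f_inv_into_f)
  show "?K (I p) = p" if "p \<in> mspace X" for p
    using inj that by simp
  show "fst (I p) \<in> mspace Y" "snd (I p) \<in> mspace Z" if "p \<in> mspace X" for p
    using im that by (metis imageI mem_Times_iff)+
qed (use assms in \<open>auto simp: decomposition_def isometry_prod_iff\<close>)

section \<open>Translation flows\<close>

text \<open>Here \<open>n\<close> is the squared speed. Moving along a coordinate \<open>h\<close>
  with speed \<open>s\<close> corresponds to \<open>b = s * h\<close> and \<open>n = s^2\<close>,
  and the formula expands \<open>(h p - h q - t * s)^2\<close> plus the squared distance in the
  other factor. The group law is not imposed; it is recovered from uniqueness.\<close>

definition split_flow :: "'a metric \<Rightarrow> ('a \<Rightarrow> real) \<Rightarrow> real \<Rightarrow> (real \<Rightarrow> 'a \<Rightarrow> 'a) \<Rightarrow> bool" where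
  "split_flow X b n \<phi> \<longleftrightarrow> (\<forall>t. \<forall>q\<in>mspace X. \<phi> t q \<in> mspace X \<and>
     (\<forall>p\<in>mspace X. (mdist X p (\<phi> t q))\<^sup>2 = (mdist X p q)\<^sup>2 - 2 * t * (b p - b q) + t\<^sup>2 * n))"

lemma split_flow_mem: "split_flow X b n \<phi> \<Longrightarrow> q \<in> mspace X \<Longrightarrow> \<phi> t q \<in> mspace X"
  by (simp add: split_flow_def)

lemma split_flow_dist: "split_flow X b n \<phi> \<Longrightarrow> p \<in> mspace X \<Longrightarrow> q \<in> mspace X \<Longrightarrow>
    (mdist X p (\<phi> t q))\<^sup>2 = (mdist X p q)\<^sup>2 - 2 * t * (b p - b q) + t\<^sup>2 * n"
  by (simp add: split_flow_def)

lemma split_flow_cong: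
  assumes "split_flow X b n \<phi>" "\<And>p. p \<in> mspace X \<Longrightarrow> b' p = b p + c"
  shows "split_flow X b' n \<phi>"
  using assms by (simp add: split_flow_def)

text \<open>Taking the image point itself for \<open>p\<close> makes the left-hand side of the
  identity vanish. Solving for the height then divides by \<open>t\<close>, so that
  \<open>t = 0\<close> is treated separately.\<close>

lemma split_flow_height:
  assumes "split_flow X b n \<phi>" "q \<in> mspace X"
  shows "b (\<phi> t q) = b q + t * n"
proof (cases "t = 0")
  case True
  have "(mdist X q (\<phi> 0 q))\<^sup>2 = 0" using split_flow_dist[OF assms(1,2,2), of 0] assms by simp
  then have "\<phi> 0 q = q" using assms split_flow_mem[OF assms] by simp
  then show ?thesis using True by simp
next
  case False
  have m: "\<phi> t q \<in> mspace X" using assms by (rule split_flow_mem)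
  have "0 = (mdist X (\<phi> t q) q)\<^sup>2 - 2 * t * (b (\<phi> t q) - b q) + t\<^sup>2 * n"
    using split_flow_dist[OF assms(1) m assms(2), of t] mdist_zero[OF m m] by simp
  moreover have "(mdist X (\<phi> t q) q)\<^sup>2 = t\<^sup>2 * n"
    using split_flow_dist[OF assms(1,2,2), of t] assms by (simp add: mdist_commute)
  ultimately have "t * (b (\<phi> t q) - b q - t * n) = 0" by (simp add: algebra_simps power2_eq_square)
  then show ?thesis using False by simp
qed

text \<open>With \<open>p = r\<close> the defining polynomial becomes
  \<open>t^2 * n - 2 * t^2 * n + t^2 * n = 0\<close>. Later arguments identify image points in this
  way.\<close>

lemma split_flow_unique:
  assumes \<phi>: "split_flow X b n \<phi>" and q: "q \<in> mspace X" and r: "r \<in> mspace X"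
    and b: "b r = b q + t * n" and d: "(mdist X q r)\<^sup>2 = t\<^sup>2 * n"
  shows "\<phi> t q = r"
proof -
  have "(mdist X r (\<phi> t q))\<^sup>2 = 0"
    using split_flow_dist[OF \<phi> r q, of t] b d
    by (simp add: mdist_commute algebra_simps power2_eq_square)
  then show ?thesis using r split_flow_mem[OF \<phi> q] by simp
qed

text \<open>Both sides come from expanding the squared distance between the images of \<open>p\<close> under one
  flow and of \<open>q\<close> under the other in the two possible orders. Hence the slope of one height
  function along the flow of the other is a constant, symmetric in the two flows.\<close>

lemma split_flow_slope:
  assumes 1: "split_flow X b n \<phi>" and 2: "split_flow X c m \<psi>"
    and p: "p \<in> mspace X" and q: "q \<in> mspace X"
  shows "t * (c (\<phi> s p) - c p) = s * (b (\<psi> t q) - b q)"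
proof -
  have m: "\<phi> s p \<in> mspace X" "\<psi> t q \<in> mspace X"
    using split_flow_mem[OF 1 p] split_flow_mem[OF 2 q] .
  show ?thesis
    using split_flow_dist[OF 1 m(2) p, of s] split_flow_dist[OF 2 m(1) q, of t]
      split_flow_dist[OF 1 q p, of s] split_flow_dist[OF 2 p q, of t]
    by (simp add: mdist_commute algebra_simps)
qed

lemma split_flow_scale:
  assumes "split_flow X b n \<phi>"
  shows "split_flow X (\<lambda>p. a * b p) (a\<^sup>2 * n) (\<lambda>t. \<phi> (a * t))"
  unfolding split_flow_def
  by (simp add: split_flow_mem[OF assms] split_flow_dist[OF assms]) (simp add: algebra_simps power2_eq_square)

section \<open>Splittings of a line and flows\<close>

lemma split_flow_of_isometry:
  fixes Y :: "'b metric"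
  assumes "isometry X (prod_metric (euclidean_metric :: real metric) Y) \<Phi>"
  obtains \<phi> where "split_flow X (\<lambda>p. fst (\<Phi> p)) 1 \<phi>"
    and "\<And>t p. p \<in> mspace X \<Longrightarrow> \<Phi> (\<phi> t p) = (fst (\<Phi> p) + t, snd (\<Phi> p))"
proof -
  obtain K where K: "\<And>y z. z \<in> mspace Y \<Longrightarrow> K (y, z) \<in> mspace X"
    "\<And>y z. z \<in> mspace Y \<Longrightarrow> \<Phi> (K (y, z)) = (y, z)"
    and mem: "\<And>p. p \<in> mspace X \<Longrightarrow> snd (\<Phi> p) \<in> mspace Y"
    and d: "\<And>p q. p \<in> mspace X \<Longrightarrow> q \<in> mspace X \<Longrightarrow> (mdist X p q)\<^sup>2 =
        (dist (fst (\<Phi> p)) (fst (\<Phi> q)))\<^sup>2 + (mdist Y (snd (\<Phi> p)) (snd (\<Phi> q)))\<^sup>2"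
    using assms[folded decomposition_def] by (rule decompositionE) auto
  define \<phi> where "\<phi> t p = K (fst (\<Phi> p) + t, snd (\<Phi> p))" for t p
  have \<phi>: "\<phi> t p \<in> mspace X" "\<Phi> (\<phi> t p) = (fst (\<Phi> p) + t, snd (\<Phi> p))" if "p \<in> mspace X" for t p
    using K mem that by (simp_all add: \<phi>_def)
  have "split_flow X (\<lambda>p. fst (\<Phi> p)) 1 \<phi>"
    unfolding split_flow_def
  proof (intro allI ballI conjI)
    fix t p q assume "q \<in> mspace X" "p \<in> mspace X"
    then show "(mdist X p (\<phi> t q))\<^sup>2 = (mdist X p q)\<^sup>2 - 2 * t * (fst (\<Phi> p) - fst (\<Phi> q)) + t\<^sup>2 * 1"
      by (simp add: \<phi> d dist_real_def) (simp add: algebra_simps power2_eq_square)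
  qed (rule \<phi>)
  then show thesis using \<phi>(2) by (rule that)
qed

text \<open>The complementary factor is the zero level of \<open>b\<close>; a point reaches it along
  its own flow line after time \<open>- b p\<close>.\<close>

lemma isometry_of_split_flow:
  assumes \<phi>: "split_flow X b 1 \<phi>"
  shows "isometry X (prod_metric (euclidean_metric :: real metric)
    (submetric X {p \<in> mspace X. b p = 0})) (\<lambda>p. (b p, \<phi> (- b p) p))"
  unfolding isometry_prod_iff
proof (intro conjI ballI)
  note mem = split_flow_mem[OF \<phi>] and h = split_flow_height[OF \<phi>] and d = split_flow_dist[OF \<phi>]
  let ?Y = "{p \<in> mspace X. b p = 0}"
  show "(\<lambda>p. (b p, \<phi> (- b p) p)) ` mspace X =
      mspace (euclidean_metric :: real metric) \<times> mspace (submetric X ?Y)"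
  proof -
    have "(t, y) \<in> (\<lambda>p. (b p, \<phi> (- b p) p)) ` mspace X" if y: "y \<in> mspace X" "b y = 0" for t y
    proof -
      have "\<phi> (- t) (\<phi> t y) = y"
        by (rule split_flow_unique[OF \<phi>])
          (use y mem[OF y(1)] h[OF y(1)] d[OF y(1) y(1)] in \<open>auto simp: mdist_commute\<close>)
      then show ?thesis using y mem[OF y(1)] h[OF y(1)] by (auto simp: image_iff intro!: bexI[of _ "\<phi> t y"])
    qed
    then show ?thesis using mem h by auto
  qed
  fix p q assume p: "p \<in> mspace X" and q: "q \<in> mspace X"
  \<comment> \<open>The two points are moved one at a time: \<open>q\<close> against the already
    moved \<open>p\<close>, whose height is now zero, and then \<open>p\<close> against the fixed
    \<open>q\<close>.\<close>
  have "(mdist X (\<phi> (- b p) p) (\<phi> (- b q) q))\<^sup>2 = (mdist X p q)\<^sup>2 - (b p - b q)\<^sup>2"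
    using d[OF mem[OF p] q, of "- b p" "- b q"] d[OF q p, of "- b p"] h[OF p, of "- b p"]
      mdist_commute[of X q p] mdist_commute[of X q "\<phi> (- b p) p"]
    by (simp add: algebra_simps power2_eq_square)
  then show "(mdist X p q)\<^sup>2 = (mdist euclidean_metric (fst (b p, \<phi> (- b p) p)) (fst (b q, \<phi> (- b q) q)))\<^sup>2 +
     (mdist (submetric X ?Y) (snd (b p, \<phi> (- b p) p)) (snd (b q, \<phi> (- b q) q)))\<^sup>2"
    by (simp add: dist_real_def)
qed

lemma splitting_line_of_split_flow:
  assumes \<phi>: "split_flow X b n \<phi>" and n: "n > 0" and x: "x \<in> mspace X"
  shows "splitting_line X (range (\<lambda>t. \<phi> t x))"
proof -
  \<comment> \<open>Rescaling time by \<open>s\<close> gives unit speed. The shift in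
    \<open>c\<close> puts \<open>x\<close> on the zero level, so that \<open>x\<close> is the second
    coordinate of every point of its orbit.\<close>
  define s where "s = 1 / sqrt n"
  have s: "s\<^sup>2 * n = 1" "s \<noteq> 0" using n by (auto simp: s_def power_divide)
  define c where "c p = s * (b p - b x)" for p
  define \<psi> where "\<psi> t = \<phi> (s * t)" for t
  have \<psi>: "split_flow X c 1 \<psi>"
    using split_flow_cong[OF split_flow_scale[OF \<phi>, of s], of c "- s * b x"] s(1)
    by (simp add: c_def \<psi>_def[abs_def] algebra_simps)
  have range: "range (\<lambda>t. \<phi> t x) = range (\<lambda>t. \<psi> t x)"
  proof -
    have "\<phi> t x = \<psi> (t / s) x" for t using s(2) by (simp add: \<psi>_def)
    then have "\<phi> t x \<in> range (\<lambda>t. \<psi> t x)" for t by blast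
    then show ?thesis by (auto simp: \<psi>_def)
  qed
  note mem = split_flow_mem[OF \<psi> x] and h = split_flow_height[OF \<psi> x]
  have cx: "c x = 0" by (simp add: c_def)
  define l where "l = range (\<lambda>t. \<psi> t x)"
  have lX: "l \<subseteq> mspace X" using mem by (auto simp: l_def)
  have "mdist X (\<psi> t x) (\<psi> u x) = \<bar>t - u\<bar>" for t u
  proof -
    have "(mdist X (\<psi> t x) (\<psi> u x))\<^sup>2 = \<bar>t - u\<bar>\<^sup>2"
      using split_flow_dist[OF \<psi> mem x, of t u] split_flow_dist[OF \<psi> x x, of t] x h cx
      by (simp add: mdist_commute algebra_simps power2_eq_square)
    then show ?thesis by (rule power2_eq_imp_eq) auto
  qed
  then have "isometry (submetric X l) (euclidean_metric :: real metric) c"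
    using lX h cx by (auto simp: isometry_def l_def Int_absorb2 dist_real_def image_iff)
  then have "line_in X l" using lX by (auto simp: line_in_def isometric_def)
  moreover have "\<psi> (- c p) p = x" if l: "p \<in> l" for p
  proof -
    obtain t where "p = \<psi> t x" using l by (auto simp: l_def)
    then show ?thesis using split_flow_unique[OF \<psi> mem x, of t "- c p"]
        h cx split_flow_dist[OF \<psi> x x, of t] x by (simp add: mdist_commute)
  qed
  ultimately have "splitting_line X l"
    by (intro splitting_lineI[OF _ isometry_of_split_flow[OF \<psi>]]) auto
  then show ?thesis by (simp add: range l_def)
qed

text \<open>The flow acts on the second coordinate only, and the unchanged first coordinate adds the
  same square to both sides.\<close>

lemma split_flow_lift_snd:
  assumes "decomposition X Y Z I" and \<phi>: "split_flow Z b n \<phi>"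
  obtains \<psi> where "split_flow X (\<lambda>p. b (snd (I p))) n \<psi>"
    and "\<And>t p. p \<in> mspace X \<Longrightarrow> I (\<psi> t p) = (fst (I p), \<phi> t (snd (I p)))"
proof -
  obtain K where K: "\<And>y z. y \<in> mspace Y \<Longrightarrow> z \<in> mspace Z \<Longrightarrow> K (y, z) \<in> mspace X"
    "\<And>y z. y \<in> mspace Y \<Longrightarrow> z \<in> mspace Z \<Longrightarrow> I (K (y, z)) = (y, z)"
    and mem: "\<And>p. p \<in> mspace X \<Longrightarrow> fst (I p) \<in> mspace Y" "\<And>p. p \<in> mspace X \<Longrightarrow> snd (I p) \<in> mspace Z"
    and d: "\<And>p q. p \<in> mspace X \<Longrightarrow> q \<in> mspace X \<Longrightarrow> (mdist X p q)\<^sup>2 =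
        (mdist Y (fst (I p)) (fst (I q)))\<^sup>2 + (mdist Z (snd (I p)) (snd (I q)))\<^sup>2"
    using assms(1) by (rule decompositionE) blast
  define \<psi> where "\<psi> t p = K (fst (I p), \<phi> t (snd (I p)))" for t p
  have \<psi>: "\<psi> t p \<in> mspace X" "I (\<psi> t p) = (fst (I p), \<phi> t (snd (I p)))" if "p \<in> mspace X" for t p
    using K mem that split_flow_mem[OF \<phi>] by (simp_all add: \<psi>_def)
  have "split_flow X (\<lambda>p. b (snd (I p))) n \<psi>"
    by (simp add: split_flow_def \<psi> d mem split_flow_dist[OF \<phi>])
  then show thesis using \<psi>(2) by (rule that)
qed

section \<open>The space of translations\<close>

text \<open>A translation is encoded by its height function, normalized to vanish at the base point and
  outside the space.\<close>

locale pointed_metric_space =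
  fixes X :: "'a metric" and x0 :: 'a
  assumes x0 [simp, intro]: "x0 \<in> mspace X"
begin

definition V :: "('a \<Rightarrow> real) set" where
  "V = {b. b x0 = 0 \<and> (\<forall>p. p \<notin> mspace X \<longrightarrow> b p = 0) \<and> (\<exists>n \<phi>. split_flow X b n \<phi>)}"

text \<open>The time-one map. The choice of the flow is immaterial by \<open>split_flow_V\<close>,
  and time \<open>t\<close> is recovered as the time-one map of \<open>t * v\<close>.\<close>

definition trans :: "('a \<Rightarrow> real) \<Rightarrow> 'a \<Rightarrow> 'a" where
  "trans v = (SOME \<phi>. \<exists>n. split_flow X v n \<phi>) 1"

text \<open>As \<open>u x0 = 0\<close>, this is the gain of \<open>u\<close> under
  \<open>trans v\<close> at the base point. Linearity in \<open>u\<close> is immediate; symmetry and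
  independence of the point come from \<open>split_flow_slope\<close>.\<close>

definition ip :: "('a \<Rightarrow> real) \<Rightarrow> ('a \<Rightarrow> real) \<Rightarrow> real" where
  "ip u v = u (trans v x0)"

lemma V_base: "v \<in> V \<Longrightarrow> v x0 = 0"
  by (simp add: V_def)

lemma V_ext: "u \<in> V \<Longrightarrow> v \<in> V \<Longrightarrow> (\<And>p. p \<in> mspace X \<Longrightarrow> u p = v p) \<Longrightarrow> u = v"
  by (auto simp: V_def fun_eq_iff) metis

lemma trans_flow:
  assumes "v \<in> V"
  obtains n \<phi> where "split_flow X v n \<phi>" "trans v = \<phi> 1"
proof -
  have "\<exists>\<phi> n. split_flow X v n \<phi>" using assms by (auto simp: V_def)
  then obtain n where "split_flow X v n (SOME \<phi>. \<exists>n. split_flow X v n \<phi>)"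
    by (rule someI_ex[THEN exE])
  then show thesis by (rule that) (simp add: trans_def)
qed

lemma trans_mem [simp, intro]: "v \<in> V \<Longrightarrow> q \<in> mspace X \<Longrightarrow> trans v q \<in> mspace X"
  by (erule trans_flow) (simp add: split_flow_mem)

lemma ip_commute:
  assumes "u \<in> V" "v \<in> V"
  shows "ip u v = ip v u"
proof -
  obtain n \<phi> where 1: "split_flow X u n \<phi>" "trans u = \<phi> 1" using trans_flow[OF assms(1)] .
  obtain m \<psi> where 2: "split_flow X v m \<psi>" "trans v = \<psi> 1" using trans_flow[OF assms(2)] .
  show ?thesis
    using split_flow_slope[OF 1(1) 2(1) x0 x0, of 1 1] assms[THEN V_base] by (simp add: ip_def 1(2) 2(2))
qed

text \<open>In \<open>split_flow_slope\<close> one side involves only the first point and the other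
  only the second, so the gain at \<open>q\<close> equals the gain at \<open>x0\<close>.\<close>

lemma trans_height:
  assumes "u \<in> V" "v \<in> V" "q \<in> mspace X"
  shows "u (trans v q) = u q + ip u v"
proof -
  obtain n \<phi> where 1: "split_flow X u n \<phi>" "trans u = \<phi> 1" using trans_flow[OF assms(1)] .
  obtain m \<psi> where 2: "split_flow X v m \<psi>" "trans v = \<psi> 1" using trans_flow[OF assms(2)] .
  show ?thesis
    using split_flow_slope[OF 1(1) 2(1) x0 assms(3), of 1 1]
      split_flow_slope[OF 1(1) 2(1) x0 x0, of 1 1] assms(1,2)[THEN V_base] by (simp add: ip_def 1(2) 2(2))
qed

lemma trans_dist:
  assumes "v \<in> V" "p \<in> mspace X" "q \<in> mspace X"
  shows "(mdist X p (trans v q))\<^sup>2 = (mdist X p q)\<^sup>2 - 2 * (v p - v q) + ip v v"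
proof -
  obtain n \<phi> where 1: "split_flow X v n \<phi>" "trans v = \<phi> 1" using trans_flow[OF assms(1)] .
  have "ip v v = n" using split_flow_height[OF 1(1) x0, of 1] V_base[OF assms(1)] by (simp add: ip_def 1(2))
  then show ?thesis using split_flow_dist[OF 1(1) assms(2,3), of 1] by (simp add: 1(2))
qed

lemma trans_dist_self:
  assumes "v \<in> V" "p \<in> mspace X"
  shows "(mdist X p (trans v p))\<^sup>2 = ip v v"
  using trans_dist[OF assms assms(2)] assms by simp

lemma trans_unique:
  assumes "v \<in> V" "q \<in> mspace X" "r \<in> mspace X" "v r = v q + ip v v" "(mdist X q r)\<^sup>2 = ip v v"
  shows "trans v q = r"
proof -
  have "(mdist X r (trans v q))\<^sup>2 = 0"
    using trans_dist[OF assms(1,3,2)] assms by (simp add: mdist_commute)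
  then show ?thesis using assms by simp
qed

lemma V_zero [simp, intro]: "(\<lambda>p. 0) \<in> V"
proof -
  have "split_flow X (\<lambda>p. 0) 0 (\<lambda>t p. p)" by (simp add: split_flow_def)
  then show ?thesis by (auto simp: V_def)
qed

lemma V_scale [simp, intro]: "v \<in> V \<Longrightarrow> (\<lambda>p. c * v p) \<in> V"
  using split_flow_scale[of X v _ _ c] by (auto simp: V_def)

lemma ip_scale_right: "u \<in> V \<Longrightarrow> v \<in> V \<Longrightarrow> ip u (\<lambda>p. c * v p) = c * ip u v"
  using ip_commute[of u v] ip_commute[of u "\<lambda>p. c * v p"] V_scale[of v c]
  by (simp add: ip_def[of _ u])

lemma split_flow_trans:
  assumes "v \<in> V"
  shows "split_flow X v (ip v v) (\<lambda>t. trans (\<lambda>p. t * v p))"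
proof -
  have "ip (\<lambda>p. t * v p) (\<lambda>p. t * v p) = t\<^sup>2 * ip v v" for t
    using ip_scale_right[OF V_scale[OF assms] assms, of t t] by (simp add: ip_def power2_eq_square)
  then show ?thesis
    unfolding split_flow_def using trans_dist[OF V_scale[OF assms]] trans_mem[OF V_scale[OF assms]]
    by (simp add: right_diff_distrib)
qed

text \<open>The flows are composed. The constant gain of \<open>u\<close> along the flow of
  \<open>v\<close> turns the linear term for \<open>u\<close> into the mixed term
  \<open>2 * ip u v\<close>.\<close>

lemma V_add [simp, intro]:
  assumes u: "u \<in> V" and v: "v \<in> V"
  shows "(\<lambda>p. u p + v p) \<in> V"
proof -
  let ?\<phi> = "\<lambda>t q. trans (\<lambda>p. t * u p) (trans (\<lambda>p. t * v p) q)"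
  have "split_flow X (\<lambda>p. u p + v p) (ip u u + 2 * ip u v + ip v v) ?\<phi>"
    unfolding split_flow_def
  proof (intro allI conjI ballI)
    fix t p q assume q: "q \<in> mspace X" and p: "p \<in> mspace X"
    have m: "trans (\<lambda>p. t * v p) q \<in> mspace X" using v q by auto
    show "(mdist X p (?\<phi> t q))\<^sup>2 = (mdist X p q)\<^sup>2 - 2 * t * (u p + v p - (u q + v q)) +
        t\<^sup>2 * (ip u u + 2 * ip u v + ip v v)"
      using split_flow_dist[OF split_flow_trans[OF u] p m, of t]
        split_flow_dist[OF split_flow_trans[OF v] p q, of t] u v q
      by (simp add: trans_height ip_scale_right) (simp add: algebra_simps power2_eq_square)
  qed (use u v in auto)
  then show ?thesis using u v by (auto simp: V_def)
qed

lemma V_minus [simp, intro]: "v \<in> V \<Longrightarrow> (\<lambda>p. - v p) \<in> V"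
  using V_scale[of v "-1"] by simp

lemma V_diff [simp, intro]: "u \<in> V \<Longrightarrow> v \<in> V \<Longrightarrow> (\<lambda>p. u p - v p) \<in> V"
  using V_add[of u "\<lambda>p. - v p"] by simp

lemma ip_left [simp]:
  "ip (\<lambda>p. u p + v p) w = ip u w + ip v w" "ip (\<lambda>p. u p - v p) w = ip u w - ip v w"
  "ip (\<lambda>p. c * u p) w = c * ip u w" "ip (\<lambda>p. - u p) w = - ip u w" "ip (\<lambda>p. 0) w = 0"
  by (simp_all add: ip_def)

lemma ip_right:
  assumes "u \<in> V" "v \<in> V" "w \<in> V"
  shows "ip w (\<lambda>p. u p + v p) = ip w u + ip w v" "ip w (\<lambda>p. u p - v p) = ip w u - ip w v"
    "ip w (\<lambda>p. c * u p) = c * ip w u" "ip w (\<lambda>p. - u p) = - ip w u" "ip w (\<lambda>p. 0) = 0"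
  using assms by (simp_all add: ip_commute[OF assms(3)])

lemma ip_nonneg: "v \<in> V \<Longrightarrow> 0 \<le> ip v v"
  using trans_dist_self[of v x0] by (metis x0 zero_le_power2)

lemma ip_eq_zero:
  assumes v: "v \<in> V" and "ip v v = 0"
  shows "v = (\<lambda>p. 0)"
proof (rule V_ext[OF v V_zero])
  fix p assume p: "p \<in> mspace X"
  have "trans v x0 = x0" using trans_dist_self[OF v x0] assms by simp
  then show "v p = 0" using trans_dist[OF v p x0] assms V_base[OF v] by simp
qed

text \<open>\<open>trans_dist\<close> is applied once in each argument. For \<open>u = v\<close> the
  formula says that translations are isometries; for \<open>p = q\<close>, that the displacement
  between two translates of a point is the norm of \<open>u - v\<close>.\<close>

lemma trans_dist_trans:
  assumes "u \<in> V" "v \<in> V" "p \<in> mspace X" "q \<in> mspace X"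
  shows "(mdist X (trans u p) (trans v q))\<^sup>2 =
    (mdist X p q)\<^sup>2 + 2 * ((u p - u q) - (v p - v q)) + ip (\<lambda>p. u p - v p) (\<lambda>p. u p - v p)"
proof -
  have "(mdist X (trans u p) q)\<^sup>2 = (mdist X p q)\<^sup>2 - 2 * (u q - u p) + ip u u"
    using trans_dist[OF assms(1,4,3)] by (simp add: mdist_commute)
  then show ?thesis
    using trans_dist[OF assms(2) trans_mem[OF assms(1,3)] assms(4)] assms
    by (simp add: trans_height ip_right ip_commute[of v u])
qed

lemma trans_add:
  assumes u: "u \<in> V" and v: "v \<in> V" and q: "q \<in> mspace X"
  shows "trans (\<lambda>p. u p + v p) q = trans u (trans v q)"
proof (rule trans_unique)
  show "(mdist X q (trans u (trans v q)))\<^sup>2 = ip (\<lambda>p. u p + v p) (\<lambda>p. u p + v p)"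
    using trans_dist[OF u q trans_mem[OF v q]] trans_dist_self[OF v q] assms
    by (simp add: trans_height ip_right ip_commute[of v u])
qed (use assms in \<open>auto simp: trans_height ip_right\<close>)

lemma trans_zero [simp]: "q \<in> mspace X \<Longrightarrow> trans (\<lambda>p. 0) q = q"
  by (rule trans_unique) auto

text \<open>This brings flows obtained from splittings or from Hilbert factors into
  \<open>V\<close>: normalizing the height changes it by a constant, and uniqueness identifies the
  maps.\<close>

lemma split_flow_V:
  assumes \<phi>: "split_flow X b n \<phi>"
  defines "v \<equiv> \<lambda>p. if p \<in> mspace X then b p - b x0 else 0"
  shows "v \<in> V" and "q \<in> mspace X \<Longrightarrow> \<phi> t q = trans (\<lambda>p. t * v p) q" and "ip v v = n"
proof -
  have v: "split_flow X v n \<phi>" by (rule split_flow_cong[OF \<phi>, of _ "- b x0"]) (simp add: v_def)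
  then show V: "v \<in> V" by (auto simp: V_def v_def)
  show n: "ip v v = n"
    using split_flow_slope[OF v split_flow_trans[OF V] x0 x0, of 1 1]
      split_flow_height[OF v x0, of 1] split_flow_height[OF split_flow_trans[OF V] x0, of 1] by simp
  show "\<phi> t q = trans (\<lambda>p. t * v p) q" if q: "q \<in> mspace X"
    using split_flow_unique[OF v q trans_mem[OF V_scale[OF V] q], of t t] q V n
      split_flow_height[OF split_flow_trans[OF V] q, of t]
      split_flow_dist[OF split_flow_trans[OF V] q q, of t] by simp
qed

section \<open>Closedness of orbits\<close>

definition orbit :: "'a \<Rightarrow> 'a set" where
  "orbit q = (\<lambda>v. trans v q) ` V"

text \<open>The distance between two translates does not depend on the translated point, so
  convergence at \<open>x0\<close> makes the translations Cauchy at every point and every time. The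
  defining identity of a flow passes to the limit.\<close>

lemma orbit_closed:
  assumes X: "mcomplete_of X" and v: "\<And>k::nat. v k \<in> V" and y: "y \<in> mspace X"
    and lim: "(\<lambda>k. mdist X (trans (v k) x0) y) \<longlonglongrightarrow> 0"
  shows "y \<in> orbit x0"
proof -
  have mem: "trans (\<lambda>p. t * v k p) q \<in> mspace X" if "q \<in> mspace X" for t k q
    using v that by auto
  define N where "N k l = ip (\<lambda>p. v k p - v l p) (\<lambda>p. v k p - v l p)" for k l
  have N: "(mdist X (trans (v k) x0) (trans (v l) x0))\<^sup>2 = N k l" for k l
    using trans_dist_trans[OF v v x0 x0, of k l] v by (simp add: N_def)
  have N': "(mdist X (trans (\<lambda>p. t * v k p) q) (trans (\<lambda>p. t * v l p) q))\<^sup>2 = t\<^sup>2 * N k l"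
    if "q \<in> mspace X" for k l q t
    using trans_dist_trans[OF V_scale[OF v] V_scale[OF v] that that, of t k t l] v that
    by (simp add: N_def ip_right ip_scale_right right_diff_distrib power2_eq_square mult.assoc)
  have N_small: "\<exists>K. \<forall>m\<ge>K. \<forall>n\<ge>K. N m n < \<epsilon>\<^sup>2" if "\<epsilon> > 0" for \<epsilon>
  proof -
    obtain K where K: "\<And>k. k \<ge> K \<Longrightarrow> mdist X (trans (v k) x0) y < \<epsilon> / 2"
      using LIMSEQ_D[OF lim, of "\<epsilon> / 2"] \<open>\<epsilon> > 0\<close> by auto
    have "N m n < \<epsilon>\<^sup>2" if "m \<ge> K" "n \<ge> K" for m n
    proof -
      have "mdist X (trans (v m) x0) (trans (v n) x0) < \<epsilon>"
        using mdist_triangle[OF trans_mem[OF v x0] y trans_mem[OF v x0], of m n] K[OF that(1)] K[OF that(2)]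
        by (simp add: mdist_commute[of X y])
      then show ?thesis using N[of m n] by (metis mdist_nonneg power_strict_mono zero_less_numeral)
    qed
    then show ?thesis by blast
  qed
  have ex: "\<exists>z\<in>mspace X. (\<lambda>k. mdist X (trans (\<lambda>p. t * v k p) q) z) \<longlonglongrightarrow> 0"
    if q: "q \<in> mspace X" for t q
  proof -
    have "\<exists>K. \<forall>m\<ge>K. \<forall>n\<ge>K. mdist X (trans (\<lambda>p. t * v m p) q) (trans (\<lambda>p. t * v n p) q) < \<epsilon>"
      if "\<epsilon> > 0" for \<epsilon>
    proof -
      \<comment> \<open>Time \<open>t\<close> scales displacements by \<open>\<bar>t\<bar>\<close>;
        the summand 1 covers \<open>t = 0\<close>.\<close>
      define \<delta> where "\<delta> = \<epsilon> / (\<bar>t\<bar> + 1)"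
      have \<delta>: "\<delta> > 0" "\<bar>t\<bar> * \<delta> < \<epsilon>" using that by (auto simp: \<delta>_def field_simps)
      obtain K where K: "\<And>m n. m \<ge> K \<Longrightarrow> n \<ge> K \<Longrightarrow> N m n < \<delta>\<^sup>2" using N_small[OF \<delta>(1)] by blast
      have "mdist X (trans (\<lambda>p. t * v m p) q) (trans (\<lambda>p. t * v n p) q) < \<epsilon>"
        if "m \<ge> K" "n \<ge> K" for m n
      proof -
        have "(mdist X (trans (\<lambda>p. t * v m p) q) (trans (\<lambda>p. t * v n p) q))\<^sup>2 \<le> t\<^sup>2 * \<delta>\<^sup>2"
          unfolding N'[OF q] using K[OF that] by (intro mult_left_mono) auto
        also have "\<dots> = (\<bar>t\<bar> * \<delta>)\<^sup>2" by (simp add: power_mult_distrib)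
        finally show ?thesis using \<delta> by (meson abs_ge_zero le_less_trans less_imp_le mult_nonneg_nonneg power2_le_imp_le)
      qed
      then show ?thesis by blast
    qed
    from mcomplete_ofE[OF X mem[OF q] this] show ?thesis by blast
  qed
  define \<psi> where "\<psi> t q = (SOME z. z \<in> mspace X \<and> (\<lambda>k. mdist X (trans (\<lambda>p. t * v k p) q) z) \<longlonglongrightarrow> 0)" for t q
  have \<psi>: "\<psi> t q \<in> mspace X" "(\<lambda>k. mdist X (trans (\<lambda>p. t * v k p) q) (\<psi> t q)) \<longlonglongrightarrow> 0"
    if "q \<in> mspace X" for t q
    using someI_ex[OF ex[OF that, of t, unfolded Bex_def]] unfolding \<psi>_def by blast+
  define n where "n = (mdist X x0 y)\<^sup>2"
  \<comment> \<open>This solves \<open>trans_dist\<close> at \<open>q = x0\<close> for the height,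
    with \<open>y\<close> and \<open>n\<close> in place of the image point and the squared
    norm.\<close>
  define b where "b p = ((mdist X p x0)\<^sup>2 + n - (mdist X p y)\<^sup>2) / 2" for p
  have n: "(\<lambda>k. ip (v k) (v k)) \<longlonglongrightarrow> n"
    unfolding n_def trans_dist_self[OF v x0, symmetric]
    by (intro tendsto_power mdist_tendsto lim y x0 trans_mem v)
  have b: "(\<lambda>k. v k p) \<longlonglongrightarrow> b p" if p: "p \<in> mspace X" for p
  proof -
    have "v k p = ((mdist X p x0)\<^sup>2 + ip (v k) (v k) - (mdist X p (trans (v k) x0))\<^sup>2) / 2" for k
      using trans_dist[OF v p x0, of k] V_base[OF v] by simp
    then show ?thesis
      unfolding b_def by (simp only:) (intro tendsto_intros n mdist_tendsto lim y p trans_mem v x0; simp)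
  qed
  have "split_flow X b n \<psi>"
    unfolding split_flow_def
  proof (intro allI conjI ballI)
    fix t p q assume q: "q \<in> mspace X" and p: "p \<in> mspace X"
    have "(\<lambda>k. (mdist X p (trans (\<lambda>p. t * v k p) q))\<^sup>2) \<longlonglongrightarrow> (mdist X p (\<psi> t q))\<^sup>2"
      by (intro tendsto_power mdist_tendsto \<psi> p q mem)
    moreover have "(\<lambda>k. (mdist X p (trans (\<lambda>p. t * v k p) q))\<^sup>2) \<longlonglongrightarrow>
        (mdist X p q)\<^sup>2 - 2 * t * (b p - b q) + t\<^sup>2 * n"
      unfolding split_flow_dist[OF split_flow_trans[OF v] p q]
      by (intro tendsto_intros n b p q)
    ultimately show "(mdist X p (\<psi> t q))\<^sup>2 = (mdist X p q)\<^sup>2 - 2 * t * (b p - b q) + t\<^sup>2 * n"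
      by (rule LIMSEQ_unique)
  qed (rule \<psi>)
  note \<psi>V = split_flow_V[OF this]
  have "(\<lambda>k. mdist X y (trans (v k) x0)) \<longlonglongrightarrow> mdist X y (\<psi> 1 x0)"
    using mdist_tendsto[OF y \<psi>(1)[OF x0] mem[OF x0] \<psi>(2)[OF x0], of 1] by simp
  then have "mdist X y (\<psi> 1 x0) = 0"
    using lim LIMSEQ_unique y by (simp add: mdist_commute) blast
  then have "y = \<psi> 1 x0" using y \<psi>(1) by simp
  then show ?thesis using \<psi>V(1) \<psi>V(2)[OF x0, of 1] by (auto simp: orbit_def)
qed

end

section \<open>The Hilbert structure\<close>

lemma linear_term_zero:
  fixes a n :: real
  assumes "\<And>t. 0 \<le> 2 * t * a + t\<^sup>2 * n" "0 \<le> n"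
  shows "a = 0"
proof -
  \<comment> \<open>The polynomial is evaluated at \<open>t = - s\<close>; dividing by
    \<open>n + 1\<close> rather than \<open>n\<close> includes the case
    \<open>n = 0\<close>.\<close>
  define s where "s = a / (n + 1)"
  have a: "a = s * (n + 1)" using assms(2) by (simp add: s_def)
  have "0 \<le> 2 * - s * a + (- s)\<^sup>2 * n" by (rule assms(1))
  also have "\<dots> = - (s\<^sup>2 * (n + 2))" unfolding a by (simp add: algebra_simps power2_eq_square)
  finally have "s = 0" using assms(2) by (simp add: mult_le_0_iff)
  then show ?thesis by (simp add: a)
qed

context pointed_metric_space
begin

lemma trans_dist_base:
  assumes "u \<in> V" "v \<in> V"
  shows "(mdist X (trans u x0) (trans v x0))\<^sup>2 = ip (\<lambda>p. u p - v p) (\<lambda>p. u p - v p)"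
  using trans_dist_trans[OF assms x0 x0] by simp

text \<open>The representing vector \<open>v\<close> is found by minimizing the distance from \<open>p\<close> to the orbit of
  the base point, as in the projection theorem.\<close>

lemma riesz:
  assumes X: "mcomplete_of X" and p: "p \<in> mspace X"
  obtains v where "v \<in> V" "\<And>c. c \<in> V \<Longrightarrow> ip c v = c p"
proof -
  \<comment> \<open>Up to a constant, \<open>g\<close> is the quadratic functional
    \<open>ip v v - 2 * v p\<close>, whose minimizer represents evaluation at \<open>p\<close>.
    Being a squared distance, it is bounded below, so no a priori bound on \<open>v p\<close> has to
    be found.\<close>
  define g where "g v = (mdist X p (trans v x0))\<^sup>2" for v
  have g: "g v = (mdist X p x0)\<^sup>2 - 2 * v p + ip v v" if "v \<in> V" for v
    using trans_dist[OF that p x0] V_base[OF that] by (simp add: g_def)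
  define m where "m = Inf (g ` V)"
  have bdd: "bdd_below (g ` V)" by (rule bdd_belowI[of _ 0]) (auto simp: g_def)
  have m: "m \<le> g v" if "v \<in> V" for v
    unfolding m_def by (rule cInf_lower[OF imageI[OF that] bdd])
  have "\<exists>v\<in>V. g v < m + 1 / real (Suc k)" for k
  proof -
    have "Inf (g ` V) < m + 1 / real (Suc k)" by (simp add: m_def)
    then show ?thesis using cInf_lessD[of "g ` V"] V_zero by blast
  qed
  then obtain v where v: "\<And>k. v k \<in> V" and gv: "\<And>k. g (v k) < m + 1 / real (Suc k)" by metis
  have sq: "(mdist X (trans (v k) x0) (trans (v l) x0))\<^sup>2 \<le> 2 / real (Suc k) + 2 / real (Suc l)" for k l
  proof -
    \<comment> \<open>The midpoint: the parallelogram identity and \<open>m \<le> g u\<close> bound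
      the distance between two members of the minimizing sequence.\<close>
    define u where "u = (\<lambda>p. 1 / 2 * (v k p + v l p))"
    have u: "u \<in> V" unfolding u_def by (intro V_scale V_add v)
    have up: "u p = (v k p + v l p) / 2" by (simp add: u_def)
    have "ip u u = 1 / 4 * (ip (v k) (v k) + 2 * ip (v k) (v l) + ip (v l) (v l))"
      using v V_add[OF v v, of k l] ip_commute[OF v v, of k l]
      by (simp only: u_def ip_left ip_right ip_scale_right) (simp add: ip_right field_simps)
    then have "4 * g u = 2 * g (v k) + 2 * g (v l) - ip (\<lambda>p. v k p - v l p) (\<lambda>p. v k p - v l p)"
      using v ip_commute[OF v v, of k l] by (simp add: g[OF u] g[OF v] ip_right up field_simps)
    then show ?thesis
      using m[OF u] gv[of k] gv[of l] unfolding trans_dist_base[OF v v] by linarith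
  qed
  have mem: "trans (v k) x0 \<in> mspace X" for k using v by simp
  have "\<exists>K. \<forall>k\<ge>K. \<forall>l\<ge>K. mdist X (trans (v k) x0) (trans (v l) x0) < \<epsilon>" if "\<epsilon> > 0" for \<epsilon>
  proof -
    obtain K where K: "1 / real (Suc K) < \<epsilon>\<^sup>2 / 4"
      by (rule nat_approx_posE[of "\<epsilon>\<^sup>2 / 4"]) (use \<open>\<epsilon> > 0\<close> in simp)
    have "mdist X (trans (v k) x0) (trans (v l) x0) < \<epsilon>" if "k \<ge> K" "l \<ge> K" for k l
    proof -
      have "1 / real (Suc k) \<le> 1 / real (Suc K)" "1 / real (Suc l) \<le> 1 / real (Suc K)"
        using that by (auto intro!: divide_left_mono)
      then have "(mdist X (trans (v k) x0) (trans (v l) x0))\<^sup>2 < \<epsilon>\<^sup>2" using sq[of k l] K by simp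
      then show ?thesis using \<open>\<epsilon> > 0\<close> by (meson less_imp_le power2_less_imp_less)
    qed
    then show ?thesis by blast
  qed
  from mcomplete_ofE[OF X mem this] obtain y where y: "y \<in> mspace X"
    and lim: "(\<lambda>k. mdist X (trans (v k) x0) y) \<longlonglongrightarrow> 0" by blast
  from orbit_closed[OF X v y lim] obtain w where w: "w \<in> V" "y = trans w x0"
    by (auto simp: orbit_def)
  have "(\<lambda>k. g (v k)) \<longlonglongrightarrow> g w"
    unfolding g_def w(2)[symmetric] by (intro tendsto_power mdist_tendsto p y mem lim)
  moreover have "(\<lambda>k. m + 1 / real (Suc k)) \<longlonglongrightarrow> m + 0"
    by (intro tendsto_add tendsto_const LIMSEQ_Suc[OF lim_1_over_n])
  ultimately have "g w \<le> m + 0"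
    using gv by (intro LIMSEQ_le[of "\<lambda>k. g (v k)"]) (auto intro: less_imp_le)
  then have min: "g w \<le> g u" if "u \<in> V" for u using m[OF that] by simp
  have "ip c w = c p" if c: "c \<in> V" for c
  proof -
    \<comment> \<open>The right-hand side is the change of \<open>g\<close> from \<open>w\<close> to
      \<open>w + t * c\<close>, which is nonnegative at a minimizer.\<close>
    have "0 \<le> 2 * t * (ip c w - c p) + t\<^sup>2 * ip c c" for t
    proof -
      have tc: "(\<lambda>p. t * c p) \<in> V" using c by (rule V_scale)
      have "ip (\<lambda>p. w p + t * c p) (\<lambda>p. w p + t * c p) = ip w w + 2 * t * ip c w + t\<^sup>2 * ip c c"
        using w(1) c tc ip_commute[OF w(1) c]
        by (simp add: ip_right ip_scale_right power2_eq_square algebra_simps)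
      then show ?thesis
        using min[OF V_add[OF w(1) tc]] by (simp add: g[OF V_add[OF w(1) tc]] g[OF w(1)] algebra_simps)
    qed
    then have "ip c w - c p = 0" using ip_nonneg[OF c] by (rule linear_term_zero)
    then show ?thesis by simp
  qed
  with w(1) show thesis by (rule that)
qed

section \<open>\<open>V\<close> as a Hilbert space\<close>

definition V_module :: "(real, 'a \<Rightarrow> real) module" where
  "V_module = \<lparr>carrier = V, monoid.mult = undefined, one = undefined, ring.zero = (\<lambda>p. 0),
     add = (\<lambda>u v p. u p + v p), smult = (\<lambda>c u p. c * u p)\<rparr>"

lemma V_module_sel [simp]:
  "carrier V_module = V" "\<zero>\<^bsub>V_module\<^esub> = (\<lambda>p. 0)"
  "u \<oplus>\<^bsub>V_module\<^esub> v = (\<lambda>p. u p + v p)" "c \<odot>\<^bsub>V_module\<^esub> u = (\<lambda>p. c * u p)"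
  by (simp_all add: V_module_def)

lemma abelian_group_V: "abelian_group V_module"
proof (rule abelian_groupI)
  fix u assume "u \<in> carrier V_module"
  then show "\<exists>w\<in>carrier V_module. w \<oplus>\<^bsub>V_module\<^esub> u = \<zero>\<^bsub>V_module\<^esub>"
    by (intro bexI[of _ "\<lambda>p. - u p"]) auto
qed (auto simp: add_ac)

lemma V_module_minus: "u \<in> V \<Longrightarrow> v \<in> V \<Longrightarrow> u \<ominus>\<^bsub>V_module\<^esub> v = (\<lambda>p. u p - v p)"
  using abelian_group.minus_equality[OF abelian_group_V, of "\<lambda>p. - v p" v]
  by (auto simp: a_minus_def)

lemma cring_real_ring: "cring real_ring"
proof (rule cringI)
  show "abelian_group real_ring"
    by (rule abelian_groupI) (auto simp: real_ring_def intro: exI[of _ "- x" for x])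
  show "comm_monoid real_ring"
    by (rule comm_monoidI) (auto simp: real_ring_def)
qed (auto simp: real_ring_def algebra_simps)

lemma inner_product_space_V: "real_inner_product_space V_module ip"
proof -
  have "module real_ring V_module"
    by (rule moduleI[OF cring_real_ring abelian_group_V]) (auto simp: real_ring_def algebra_simps)
  moreover have "real_inner_product_space_axioms V_module ip"
    by unfold_locales (auto simp: ip_commute ip_nonneg ip_eq_zero)
  ultimately show ?thesis by (simp add: real_inner_product_space_def)
qed

text \<open>Pulled back from the orbit of \<open>x0\<close>, so that the orbit map is an isometry by
  construction; \<open>trans_dist_base\<close> shows that it is the norm metric.\<close>

definition V_metric :: "('a \<Rightarrow> real) metric" where
  "V_metric = metric (V, \<lambda>u v. mdist X (trans u x0) (trans v x0))"

lemma V_metric_sel [simp]: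
  "mspace V_metric = V" "mdist V_metric = (\<lambda>u v. mdist X (trans u x0) (trans v x0))"
proof -
  have "Metric_space V (\<lambda>u v. mdist X (trans u x0) (trans v x0))"
  proof
    fix u v assume u: "u \<in> V" and v: "v \<in> V"
    show "mdist X (trans u x0) (trans v x0) = 0 \<longleftrightarrow> u = v"
    proof
      assume "mdist X (trans u x0) (trans v x0) = 0"
      then have "(\<lambda>p. u p - v p) = (\<lambda>p. 0)"
        using trans_dist_base[OF u v] ip_eq_zero[OF V_diff[OF u v]] by simp
      then show "u = v" by (simp add: fun_eq_iff)
    qed (use v in simp)
  qed (auto simp: mdist_commute intro: mdist_triangle)
  then show "mspace V_metric = V" "mdist V_metric = (\<lambda>u v. mdist X (trans u x0) (trans v x0))"
    by (simp_all add: V_metric_def Metric_space.mspace_metric Metric_space.mdist_metric)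
qed

lemma hilbert_space_V:
  assumes X: "mcomplete_of X"
  shows "hilbert_space V_metric"
proof -
  have "mcomplete_of V_metric"
  proof (rule mcomplete_ofI)
    fix \<sigma> :: "nat \<Rightarrow> 'a \<Rightarrow> real"
    assume "\<And>k. \<sigma> k \<in> mspace V_metric"
      and C: "\<And>\<epsilon>. \<epsilon> > 0 \<Longrightarrow> \<exists>K. \<forall>m\<ge>K. \<forall>n\<ge>K. mdist V_metric (\<sigma> m) (\<sigma> n) < \<epsilon>"
    then have \<sigma>: "\<sigma> k \<in> V" for k by simp
    from mcomplete_ofE[OF X trans_mem[OF \<sigma> x0] C[unfolded V_metric_sel]]
    obtain y where y: "y \<in> mspace X" "(\<lambda>k. mdist X (trans (\<sigma> k) x0) y) \<longlonglongrightarrow> 0" by blast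
    from orbit_closed[OF X \<sigma> y] y(2) show "\<exists>w\<in>mspace V_metric. (\<lambda>k. mdist V_metric (\<sigma> k) w) \<longlonglongrightarrow> 0"
      by (auto simp: orbit_def)
  qed
  moreover have "mdist X (trans u x0) (trans v x0) =
      sqrt (ip (u \<ominus>\<^bsub>V_module\<^esub> v) (u \<ominus>\<^bsub>V_module\<^esub> v))" if "u \<in> V" "v \<in> V" for u v
    using that by (simp add: V_module_minus del: ip_left flip: trans_dist_base)
  ultimately show ?thesis
    unfolding hilbert_space_def using inner_product_space_V
    by (intro conjI exI[of _ V_module] exI[of _ ip]) auto
qed

lemma orbit_subset: "q \<in> mspace X \<Longrightarrow> orbit q \<subseteq> mspace X"
  by (auto simp: orbit_def)

lemma hilbert_space_orbit:
  assumes "mcomplete_of X"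
  shows "hilbert_space (submetric X (orbit x0))"
proof -
  have "isometry V_metric (submetric X (orbit x0)) (\<lambda>v. trans v x0)"
    using orbit_subset[OF x0] by (auto simp: isometry_def orbit_def)
  then show ?thesis
    using hilbert_space_isometric hilbert_space_V[OF assms] isometry_inv_into
    unfolding isometric_def by blast
qed

section \<open>Splitting off an orbit\<close>

lemma decomposition_orbit:
  assumes X: "mcomplete_of X"
  obtains I where "decomposition X (submetric X {p \<in> mspace X. \<forall>v\<in>V. v p = 0}) (submetric X (orbit x0)) I"
    and "\<And>p. p \<in> mspace X \<Longrightarrow> \<forall>v\<in>V. v p = 0 \<Longrightarrow> fst (I p) = p"
proof -
  have ex: "\<exists>v. v \<in> V \<and> (\<forall>c\<in>V. ip c v = c p)" if "p \<in> mspace X" for p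
    by (rule riesz[OF X that]) blast
  define \<pi> where "\<pi> p = (SOME v. v \<in> V \<and> (\<forall>c\<in>V. ip c v = c p))" for p
  have \<pi>V: "\<pi> p \<in> V" and \<pi>: "\<And>c. c \<in> V \<Longrightarrow> ip c (\<pi> p) = c p" if "p \<in> mspace X" for p
    using someI_ex[OF ex[OF that]] unfolding \<pi>_def by simp_all
  have \<pi>_eq: "\<pi> p = v" if "p \<in> mspace X" "v \<in> V" "\<And>c. c \<in> V \<Longrightarrow> c p = ip c v" for p v
  proof -
    have d: "(\<lambda>q. \<pi> p q - v q) \<in> V" using \<pi>V that by auto
    have "ip (\<lambda>q. \<pi> p q - v q) (\<lambda>q. \<pi> p q - v q) = 0"
      using that(3)[OF d] \<pi>[OF that(1) d] ip_right(2)[OF \<pi>V[OF that(1)] that(2) d] by simp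
    from ip_eq_zero[OF d this] show ?thesis by (simp add: fun_eq_iff)
  qed
  let ?F = "{p \<in> mspace X. \<forall>v\<in>V. v p = 0}"
  \<comment> \<open>Translating \<open>p\<close> by \<open>- \<pi> p\<close> lowers each
    \<open>c\<close> in \<open>V\<close> by \<open>ip c (\<pi> p) = c p\<close>, hence ends in the
    common zero set; the second coordinate records the translation.\<close>
  define I where "I p = (trans (\<lambda>q. - \<pi> p q) p, trans (\<pi> p) x0)" for p
  have "decomposition X (submetric X ?F) (submetric X (orbit x0)) I"
    unfolding decomposition_def isometry_prod_iff
  proof (intro conjI ballI)
    have "I p \<in> ?F \<times> orbit x0" if p: "p \<in> mspace X" for p
      using \<pi>V[OF p] \<pi>[OF p] p by (auto simp: I_def orbit_def trans_height ip_right)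
    moreover have "(y, trans v x0) \<in> I ` mspace X" if y: "y \<in> ?F" and v: "v \<in> V" for y v
    proof -
      have m: "trans v y \<in> mspace X" using y v by simp
      have "\<pi> (trans v y) = v"
        by (rule \<pi>_eq[OF m v]) (use y v in \<open>simp add: trans_height\<close>)
      moreover have "trans (\<lambda>q. - v q) (trans v y) = y"
        using trans_add[OF V_minus[OF v] v, of y] y by simp
      ultimately show ?thesis using m by (auto simp: I_def image_iff intro!: bexI[of _ "trans v y"])
    qed
    ultimately have "I ` mspace X = ?F \<times> orbit x0" unfolding orbit_def by blast
    then show "I ` mspace X = mspace (submetric X ?F) \<times> mspace (submetric X (orbit x0))"
      using orbit_subset[OF x0] by (simp add: Int_absorb2 Int_absorb1 subset_iff)
  next
    fix p q assume p: "p \<in> mspace X" and q: "q \<in> mspace X"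
    have V: "\<pi> p \<in> V" "\<pi> q \<in> V" using p q by (simp_all add: \<pi>V)
    show "(mdist X p q)\<^sup>2 = (mdist (submetric X ?F) (fst (I p)) (fst (I q)))\<^sup>2 +
        (mdist (submetric X (orbit x0)) (snd (I p)) (snd (I q)))\<^sup>2"
      \<comment> \<open>By the representing property the linear terms amount to \<open>-2\<close>
        times the squared norm of \<open>\<pi> p - \<pi> q\<close>, and the quadratic term adds it
        once. What is missing is the distance of the second coordinates.\<close>
      using trans_dist_trans[OF V_minus[OF V(1)] V_minus[OF V(2)] p q] trans_dist_base[OF V]
        \<pi>[OF p V(1)] \<pi>[OF p V(2)] \<pi>[OF q V(1)] \<pi>[OF q V(2)] V_diff[OF V]
        V_diff[OF V_minus[OF V(1)] V_minus[OF V(2)]] V_minus[OF V(1)] V_minus[OF V(2)] V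
      by (simp add: I_def ip_right)
  qed
  moreover have "fst (I p) = p" if "p \<in> mspace X" "\<forall>v\<in>V. v p = 0" for p
    using \<pi>_eq[OF that(1) V_zero] that by (simp add: I_def ip_right(5)[OF V_zero V_zero])
  ultimately show thesis by (rule that)
qed

text \<open>A flow on the common zero set lifts to \<open>X\<close>, so its normalized height
  belongs to \<open>V\<close> and must vanish on that set; yet it grows by 1 along the flow.\<close>

lemma no_splitting_line_orthogonal:
  fixes Z :: "'z metric"
  assumes X: "decomposition X (submetric X {p \<in> mspace X. \<forall>v\<in>V. v p = 0}) Z I"
    and I: "\<And>p. p \<in> mspace X \<Longrightarrow> \<forall>v\<in>V. v p = 0 \<Longrightarrow> fst (I p) = p"
  shows "\<not> splitting_line (submetric X {p \<in> mspace X. \<forall>v\<in>V. v p = 0}) l"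
proof
  define F where "F = {p \<in> mspace X. \<forall>v\<in>V. v p = 0}"
  assume "splitting_line (submetric X {p \<in> mspace X. \<forall>v\<in>V. v p = 0}) l"
  then obtain Y :: "'a metric" and \<Phi>
    where "isometry (submetric X F) (prod_metric (euclidean_metric :: real metric) Y) \<Phi>"
    by (auto simp: splitting_line_def F_def)
  then obtain \<phi> where \<phi>: "split_flow (submetric X F) (\<lambda>p. fst (\<Phi> p)) 1 \<phi>"
    by (rule split_flow_of_isometry)
  from split_flow_lift_snd[OF decomposition_swap[OF X[folded F_def]] \<phi>]
  obtain \<psi> where "split_flow X (\<lambda>p. fst (\<Phi> (snd (prod.swap (I p))))) 1 \<psi>" by blast
  then have \<psi>: "split_flow X (\<lambda>p. fst (\<Phi> (fst (I p)))) 1 \<psi>" by simp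
  note u = split_flow_V(1)[OF \<psi>]
  have x0F: "x0 \<in> F" by (simp add: F_def V_base)
  define y where "y = \<phi> 1 x0"
  have y: "y \<in> F" "fst (\<Phi> y) = fst (\<Phi> x0) + 1"
    using split_flow_mem[OF \<phi>, of x0 1] split_flow_height[OF \<phi>, of x0 1] x0F by (simp_all add: y_def)
  have "fst (I y) = y" "fst (I x0) = x0" using I y(1) x0F by (auto simp: F_def)
  then show False using u y by (auto simp: F_def dest!: bspec)
qed

text \<open>A nonzero \<open>v\<close> moves \<open>x\<close> along a splitting line, and the zero
  vector accounts for \<open>x\<close> itself. Conversely, two points of a splitting line differ
  only in the real coordinate of its splitting, so the associated flow carries one to the
  other.\<close>

lemma orbit_eq_splitting_lines:
  assumes x: "x \<in> mspace X"
  shows "orbit x = insert x (\<Union>{l. splitting_line X l \<and> x \<in> l})"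
proof
  show "orbit x \<subseteq> insert x (\<Union>{l. splitting_line X l \<and> x \<in> l})"
  proof
    fix p assume "p \<in> orbit x"
    then obtain v where v: "v \<in> V" "p = trans v x" by (auto simp: orbit_def)
    show "p \<in> insert x (\<Union>{l. splitting_line X l \<and> x \<in> l})"
    proof (cases "ip v v = 0")
      case True
      then show ?thesis using ip_eq_zero[OF v(1)] v x by simp
    next
      case False
      let ?l = "range (\<lambda>t. trans (\<lambda>p. t * v p) x)"
      have "splitting_line X ?l"
        using splitting_line_of_split_flow[OF split_flow_trans[OF v(1)] _ x] False ip_nonneg[OF v(1)]
        by simp
      moreover have "x \<in> ?l" by (rule range_eqI[of _ _ 0]) (use x in simp)
      moreover have "p \<in> ?l" by (rule range_eqI[of _ _ 1]) (simp add: v)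
      ultimately show ?thesis by blast
    qed
  qed
  have "p \<in> orbit x" if l: "splitting_line X l" and xl: "x \<in> l" and pl: "p \<in> l" for l p
  proof -
    obtain Y :: "'a metric" and \<Phi> y where
      iso: "isometry X (prod_metric (euclidean_metric :: real metric) Y) \<Phi>"
      and y: "\<forall>p\<in>l. snd (\<Phi> p) = y" and lX: "l \<subseteq> mspace X"
      using l by (auto simp: splitting_line_def line_in_def)
    from split_flow_of_isometry[OF iso]
    obtain \<phi> where \<phi>: "split_flow X (\<lambda>p. fst (\<Phi> p)) 1 \<phi>"
      and \<Phi>: "\<And>t p. p \<in> mspace X \<Longrightarrow> \<Phi> (\<phi> t p) = (fst (\<Phi> p) + t, snd (\<Phi> p))"
      by blast
    define t where "t = fst (\<Phi> p) - fst (\<Phi> x)"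
    have "\<Phi> (\<phi> t x) = \<Phi> p" using \<Phi>[OF x, of t] y xl pl by (simp add: t_def prod_eq_iff)
    then have "p = \<phi> t x"
      using isometry_inj_on[OF iso] split_flow_mem[OF \<phi> x] lX pl by (auto dest: inj_onD)
    then show ?thesis
      using split_flow_V(2)[OF \<phi> x, of t] V_scale[OF split_flow_V(1)[OF \<phi>], of t]
      unfolding orbit_def by blast
  qed
  moreover have "x \<in> orbit x" using x V_zero trans_zero unfolding orbit_def by (metis image_eqI)
  ultimately show "insert x (\<Union>{l. splitting_line X l \<and> x \<in> l}) \<subseteq> orbit x" by blast
qed

end

section \<open>Hilbert factors\<close>

text \<open>The flow translates in the direction \<open>k - h\<close>, and its height is the inner
  product with this vector.\<close>

lemma hilbert_split_flow:
  assumes H: "hilbert_space H" and h: "h \<in> mspace H" and k: "k \<in> mspace H"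
  obtains b n \<phi> where "split_flow H b n \<phi>" "\<phi> 1 h = k"
proof -
  obtain W ip where W: "real_inner_product_space W ip" and car: "carrier W = mspace H"
    and d: "\<And>u v. \<lbrakk>u \<in> mspace H; v \<in> mspace H\<rbrakk> \<Longrightarrow>
      mdist H u v = sqrt (ip (u \<ominus>\<^bsub>W\<^esub> v) (u \<ominus>\<^bsub>W\<^esub> v))"
    using H by (auto simp: hilbert_space_def)
  interpret W: real_inner_product_space W ip by (rule W)
  have sm [simp]: "c \<odot>\<^bsub>W\<^esub> u \<in> carrier W" if "u \<in> carrier W" for c u
    using W.smult_closed that by (simp add: real_ring_def)
  have neg: "ip (\<ominus>\<^bsub>W\<^esub> u) v = - ip u v" if "u \<in> carrier W" "v \<in> carrier W" for u v
  proof -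
    have z: "ip \<zero>\<^bsub>W\<^esub> v = 0"
      using W.ip_add_left[of "\<zero>\<^bsub>W\<^esub>" "\<zero>\<^bsub>W\<^esub>" v] that by simp
    have "ip (\<ominus>\<^bsub>W\<^esub> u) v + ip u v = ip \<zero>\<^bsub>W\<^esub> v"
      using W.ip_add_left[of "\<ominus>\<^bsub>W\<^esub> u" u v] that by (simp add: W.M.l_neg)
    then show ?thesis using z by simp
  qed
  have diff: "ip (u \<ominus>\<^bsub>W\<^esub> v) w = ip u w - ip v w"
    if "u \<in> carrier W" "v \<in> carrier W" "w \<in> carrier W" for u v w
    using that W.ip_add_left[of u "\<ominus>\<^bsub>W\<^esub> v" w] neg[of v w] by (simp add: a_minus_def)
  have d2: "(mdist H u v)\<^sup>2 = ip u u - 2 * ip u v + ip v v" if "u \<in> carrier W" "v \<in> carrier W" for u v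
  proof -
    have m: "u \<ominus>\<^bsub>W\<^esub> v \<in> carrier W" using that by simp
    have "(mdist H u v)\<^sup>2 = ip (u \<ominus>\<^bsub>W\<^esub> v) (u \<ominus>\<^bsub>W\<^esub> v)"
      using d that W.ip_nonneg[OF m] by (simp add: car)
    also have "\<dots> = ip u (u \<ominus>\<^bsub>W\<^esub> v) - ip v (u \<ominus>\<^bsub>W\<^esub> v)" using diff[OF that m] .
    also have "ip u (u \<ominus>\<^bsub>W\<^esub> v) = ip u u - ip v u"
      using W.ip_commute[OF that(1) m] diff[OF that that(1)] by simp
    also have "ip v (u \<ominus>\<^bsub>W\<^esub> v) = ip u v - ip v v"
      using W.ip_commute[OF that(2) m] diff[OF that that(2)] by simp
    finally show ?thesis using W.ip_commute[OF that] by simp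
  qed
  define w where "w = k \<ominus>\<^bsub>W\<^esub> h"
  have w: "w \<in> carrier W" using h k W.M.minus_closed by (simp add: w_def flip: car)
  define \<phi> where "\<phi> t q = q \<oplus>\<^bsub>W\<^esub> (t \<odot>\<^bsub>W\<^esub> w)" for t q
  have "split_flow H (\<lambda>p. ip p w) (ip w w) \<phi>"
    unfolding split_flow_def car[symmetric]
  proof (intro allI ballI conjI)
    fix t p q assume q: "q \<in> carrier W" and p: "p \<in> carrier W"
    have tw: "t \<odot>\<^bsub>W\<^esub> w \<in> carrier W" using w by simp
    have m: "\<phi> t q \<in> carrier W" using q tw by (simp add: \<phi>_def)
    have 1: "ip (\<phi> t q) u = ip q u + t * ip w u" if "u \<in> carrier W" for u
      unfolding \<phi>_def using W.ip_add_left[OF q tw that] W.ip_smult_left[OF w that] by simp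
    have 2: "ip p (\<phi> t q) = ip q p + t * ip w p"
      using 1[OF p] W.ip_commute[OF p m] by simp
    have 3: "ip (\<phi> t q) (\<phi> t q) = ip q q + t * ip q w + t * (ip q w + t * ip w w)"
      using 1[OF m] 1[OF q] 1[OF w] W.ip_commute[OF q m] W.ip_commute[OF w m] W.ip_commute[OF w q] by simp
    show "(mdist H p (\<phi> t q))\<^sup>2 = (mdist H p q)\<^sup>2 - 2 * t * (ip p w - ip q w) + t\<^sup>2 * ip w w"
      unfolding d2[OF p m] d2[OF p q] 2 3 W.ip_commute[OF q p] W.ip_commute[OF w p]
      by (simp add: algebra_simps power2_eq_square)
  qed (use w in \<open>simp add: \<phi>_def\<close>)
  moreover have "\<phi> 1 h = k"
  proof -
    have "1 \<odot>\<^bsub>W\<^esub> w = w" using W.smult_one[OF w] by (simp add: real_ring_def)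
    then have "\<phi> 1 h = w \<oplus>\<^bsub>W\<^esub> h" using w h W.M.a_comm by (simp add: \<phi>_def car)
    also have "\<dots> = k \<oplus>\<^bsub>W\<^esub> (\<ominus>\<^bsub>W\<^esub> h \<oplus>\<^bsub>W\<^esub> h)"
      using h k W.M.a_inv_closed by (simp add: w_def a_minus_def W.M.a_assoc flip: car)
    also have "\<dots> = k" using h k by (simp add: W.M.l_neg car)
    finally show ?thesis .
  qed
  ultimately show thesis by (rule that)
qed

lemma fst_fiber_isometry:
  assumes D: "decomposition X Y Z I" and x: "x \<in> mspace X"
  shows "isometry (submetric X (fst_fiber X I x)) Y (\<lambda>p. fst (I p))"
proof -
  obtain K where K: "\<And>y z. y \<in> mspace Y \<Longrightarrow> z \<in> mspace Z \<Longrightarrow> K (y, z) \<in> mspace X"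
    "\<And>y z. y \<in> mspace Y \<Longrightarrow> z \<in> mspace Z \<Longrightarrow> I (K (y, z)) = (y, z)"
    and mem: "\<And>p. p \<in> mspace X \<Longrightarrow> fst (I p) \<in> mspace Y" "\<And>p. p \<in> mspace X \<Longrightarrow> snd (I p) \<in> mspace Z"
    and d: "\<And>p q. p \<in> mspace X \<Longrightarrow> q \<in> mspace X \<Longrightarrow> (mdist X p q)\<^sup>2 =
        (mdist Y (fst (I p)) (fst (I q)))\<^sup>2 + (mdist Z (snd (I p)) (snd (I q)))\<^sup>2"
    using D by (rule decompositionE) blast
  have "y \<in> (\<lambda>p. fst (I p)) ` fst_fiber X I x" if "y \<in> mspace Y" for y
    using K[OF that mem(2)[OF x]] by (auto simp: fst_fiber_def image_iff intro!: bexI[of _ "K (y, snd (I x))"])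
  then have "(\<lambda>p. fst (I p)) ` fst_fiber X I x = mspace Y"
    using mem(1) by (auto simp: fst_fiber_def)
  moreover have "mdist Y (fst (I p)) (fst (I q)) = mdist X p q"
    if "p \<in> fst_fiber X I x" "q \<in> fst_fiber X I x" for p q
  proof -
    have "(mdist X p q)\<^sup>2 = (mdist Y (fst (I p)) (fst (I q)))\<^sup>2"
      using d[of p q] that mem(2)[OF x] by (simp add: fst_fiber_def)
    then show ?thesis by simp
  qed
  moreover have "fst_fiber X I x \<subseteq> mspace X" by (auto simp: fst_fiber_def)
  ultimately show ?thesis by (simp add: isometry_def Int_absorb2)
qed

lemma fst_fiber_swap: "fst_fiber X (\<lambda>p. prod.swap (I p)) x = snd_fiber X I x"
  by (simp add: fst_fiber_def snd_fiber_def)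

lemma snd_fiber_swap: "snd_fiber X (\<lambda>p. prod.swap (I p)) x = fst_fiber X I x"
  by (simp add: fst_fiber_def snd_fiber_def)

context pointed_metric_space
begin

text \<open>A translation of \<open>H\<close> is lifted to \<open>X\<close>. The last conclusion,
  dependence on the \<open>H\<close>-coordinate alone, is how later proofs express that
  \<open>v\<close> comes from \<open>H\<close>.\<close>

lemma hilbert_fiber_translation:
  assumes D: "decomposition X Y H I" and H: "hilbert_space H"
    and x: "x \<in> mspace X" and p: "p \<in> mspace X" "fst (I p) = fst (I x)"
  obtains v where "v \<in> V" "trans v x = p"
    and "\<And>q r. \<lbrakk>q \<in> mspace X; r \<in> mspace X; snd (I q) = snd (I r)\<rbrakk> \<Longrightarrow> v q = v r"
proof -
  have inj: "inj_on I (mspace X)"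
    using D unfolding decomposition_def by (rule isometry_inj_on)
  have mem: "snd (I q) \<in> mspace H" if "q \<in> mspace X" for q
    using D by (rule decompositionE) (use that in blast)
  obtain b n \<phi> where \<phi>: "split_flow H b n \<phi>" "\<phi> 1 (snd (I x)) = snd (I p)"
    using hilbert_split_flow[OF H mem[OF x] mem[OF p(1)]] .
  from split_flow_lift_snd[OF D \<phi>(1)] obtain \<psi> where \<psi>: "split_flow X (\<lambda>p. b (snd (I p))) n \<psi>"
    and I\<psi>: "\<And>t p. p \<in> mspace X \<Longrightarrow> I (\<psi> t p) = (fst (I p), \<phi> t (snd (I p)))" by blast
  have "I (\<psi> 1 x) = I p" using I\<psi>[OF x, of 1] \<phi>(2) p(2) by (simp add: prod_eq_iff)
  then have "\<psi> 1 x = p" using inj split_flow_mem[OF \<psi> x] p(1) by (auto dest: inj_onD)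
  with split_flow_V(1)[OF \<psi>] split_flow_V(2)[OF \<psi> x, of 1] show thesis
    by (intro that[of "\<lambda>p. if p \<in> mspace X then b (snd (I p)) - b (snd (I x0)) else 0"]) auto
qed

text \<open>\<open>Y\<close> is arbitrary here, so this also bounds the Hilbert factors that compete
  with the maximal one.\<close>

lemma hilbert_fiber_subset_orbit:
  assumes "decomposition X Y H I" "hilbert_space H" "x \<in> mspace X"
  shows "snd_fiber X I x \<subseteq> orbit x"
proof
  fix p assume "p \<in> snd_fiber X I x"
  then have p: "p \<in> mspace X" "fst (I p) = fst (I x)" by (auto simp: snd_fiber_def)
  from hilbert_fiber_translation[OF assms p] show "p \<in> orbit x" unfolding orbit_def by blast
qed

text \<open>Subtract from a translation \<open>v\<close> the one coming from \<open>H\<close> with the same effect on the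
  \<open>H\<close>-coordinate of \<open>x\<close>. The difference is orthogonal to all translations coming from \<open>H\<close>, hence
  acts on \<open>Y\<close>, and it vanishes as otherwise its orbits would be splitting lines of \<open>Y\<close>.\<close>

lemma translation_of_hilbert_factor:
  fixes Y :: "'y metric" and H :: "'h metric"
  assumes D: "decomposition X Y H I" and Y: "\<nexists>l. splitting_line Y l" and H: "hilbert_space H"
    and v: "v \<in> V" and x: "x \<in> mspace X"
  shows "fst (I (trans v x)) = fst (I x)"
    and "\<And>q r. \<lbrakk>q \<in> mspace X; r \<in> mspace X; snd (I q) = snd (I r)\<rbrakk> \<Longrightarrow> v q = v r"
proof -
  obtain K where K: "\<And>y z. y \<in> mspace Y \<Longrightarrow> z \<in> mspace H \<Longrightarrow> K (y, z) \<in> mspace X"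
    "\<And>y z. y \<in> mspace Y \<Longrightarrow> z \<in> mspace H \<Longrightarrow> I (K (y, z)) = (y, z)"
    and mem: "\<And>p. p \<in> mspace X \<Longrightarrow> fst (I p) \<in> mspace Y" "\<And>p. p \<in> mspace X \<Longrightarrow> snd (I p) \<in> mspace H"
    and d: "\<And>p q. p \<in> mspace X \<Longrightarrow> q \<in> mspace X \<Longrightarrow> (mdist X p q)\<^sup>2 =
        (mdist Y (fst (I p)) (fst (I q)))\<^sup>2 + (mdist H (snd (I p)) (snd (I q)))\<^sup>2"
    using D by (rule decompositionE) blast
  \<comment> \<open>The point of the \<open>H\<close>-fiber through \<open>x\<close> that shares its
    \<open>H\<close>-coordinate with \<open>trans v x\<close>.\<close>
  define z where "z = K (fst (I x), snd (I (trans v x)))"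
  have vx: "trans v x \<in> mspace X" using v x by simp
  have z: "z \<in> mspace X" "I z = (fst (I x), snd (I (trans v x)))"
    unfolding z_def using K[OF mem(1)[OF x] mem(2)[OF vx]] by auto
  have "fst (I z) = fst (I x)" by (simp add: z(2))
  from hilbert_fiber_translation[OF D H x z(1) this] obtain v' where v': "v' \<in> V" "trans v' x = z"
    and v'_snd: "\<And>q r. \<lbrakk>q \<in> mspace X; r \<in> mspace X; snd (I q) = snd (I r)\<rbrakk> \<Longrightarrow> v' q = v' r" by blast
  define w where "w = (\<lambda>p. v p - v' p)"
  have w: "w \<in> V" using v v'(1) by (auto simp: w_def)
  define A where "A t = trans (\<lambda>p. t * w p)" for t
  have A_mem: "A t q \<in> mspace X" if "q \<in> mspace X" for t q using w that by (auto simp: A_def)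
  have orth: "ip u w = 0"
    if u: "u \<in> V" and u_snd: "\<And>q r. \<lbrakk>q \<in> mspace X; r \<in> mspace X; snd (I q) = snd (I r)\<rbrakk> \<Longrightarrow> u q = u r"
    for u
  proof -
    have "u (trans v x) = u z" by (rule u_snd[OF vx z(1)]) (simp add: z(2))
    then have "ip u v = ip u v'"
      using trans_height[OF u v x] trans_height[OF u v'(1) x] v'(2) by simp
    then show ?thesis using ip_right(2)[OF v v'(1) u] by (simp add: w_def)
  qed
  have A_snd: "snd (I (A t q)) = snd (I q)" if q: "q \<in> mspace X" for t q
  proof -
    \<comment> \<open>If \<open>A\<close> changed the \<open>H\<close>-coordinate of
      \<open>q\<close>, a translation \<open>u\<close> from \<open>H\<close> would carry
      \<open>q\<close> to \<open>r\<close>. It has equal values at \<open>r\<close> and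
      \<open>A t q\<close>, but \<open>A\<close> preserves \<open>u\<close> by orthogonality, so
      \<open>ip u u = 0\<close>.\<close>
    define r where "r = K (fst (I q), snd (I (A t q)))"
    have r: "r \<in> mspace X" "I r = (fst (I q), snd (I (A t q)))"
      unfolding r_def using K[OF mem(1)[OF q] mem(2)[OF A_mem[OF q]]] by auto
    have "fst (I r) = fst (I q)" by (simp add: r(2))
    from hilbert_fiber_translation[OF D H q r(1) this] obtain u where u: "u \<in> V" "trans u q = r"
      and u_snd: "\<And>q r. \<lbrakk>q \<in> mspace X; r \<in> mspace X; snd (I q) = snd (I r)\<rbrakk> \<Longrightarrow> u q = u r" by blast
    have "u r = u (A t q)" by (rule u_snd[OF r(1) A_mem[OF q]]) (simp add: r(2))
    moreover have "ip u w = 0" by (rule orth[OF u(1)]) (rule u_snd)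
    then have "u (A t q) = u q"
      using trans_height[OF u(1) V_scale[OF w] q, of t] ip_scale_right[OF u(1) w, of t]
      by (simp add: A_def)
    ultimately have "ip u u = 0" using trans_height[OF u(1) u(1) q] u(2) by simp
    then have "r = q" using ip_eq_zero[OF u(1)] u(2) q by simp
    then show ?thesis using arg_cong[OF r(2), of snd] by simp
  qed
  define h where "h = snd (I x)"
  have h: "h \<in> mspace H" using mem x by (simp add: h_def)
  \<comment> \<open>\<open>A\<close> preserves the slice at the fixed \<open>H\<close>-coordinate
    \<open>h\<close>, which is a copy of \<open>Y\<close>.\<close>
  define \<phi> where "\<phi> t y = fst (I (A t (K (y, h))))" for t y
  have I\<phi>: "I (A t (K (y, h))) = (\<phi> t y, h)" if "y \<in> mspace Y" for t y
    using A_snd[OF K(1)[OF that h], of t] K(2)[OF that h] by (simp add: \<phi>_def prod_eq_iff)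
  have "split_flow Y (\<lambda>y. w (K (y, h))) (ip w w) \<phi>"
    unfolding split_flow_def
  proof (intro allI ballI conjI)
    fix t p q assume q: "q \<in> mspace Y" and p: "p \<in> mspace Y"
    show "(mdist Y p (\<phi> t q))\<^sup>2 = (mdist Y p q)\<^sup>2 - 2 * t * (w (K (p, h)) - w (K (q, h))) + t\<^sup>2 * ip w w"
      using split_flow_dist[OF split_flow_trans[OF w] K(1)[OF p h] K(1)[OF q h], of t]
        d[OF K(1)[OF p h] A_mem[OF K(1)[OF q h]], of t] d[OF K(1)[OF p h] K(1)[OF q h]]
        K(2)[OF p h] K(2)[OF q h] I\<phi>[OF q] h by (simp add: A_def)
  next
    fix t q assume "q \<in> mspace Y"
    then show "\<phi> t q \<in> mspace Y" unfolding \<phi>_def by (intro mem A_mem K h)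
  qed
  from splitting_line_of_split_flow[OF this _ mem(1)[OF x]] Y have "\<not> 0 < ip w w" by blast
  then have "w = (\<lambda>p. 0)" using ip_nonneg[OF w] ip_eq_zero[OF w] by simp
  then have "v = v'" by (simp add: w_def fun_eq_iff)
  then show "fst (I (trans v x)) = fst (I x)" using v'(2) arg_cong[OF z(2), of fst] by simp
  show "v q = v r" if "q \<in> mspace X" "r \<in> mspace X" "snd (I q) = snd (I r)" for q r
    unfolding \<open>v = v'\<close> using that by (rule v'_snd)
qed

text \<open>Neither right-hand side mentions the decomposition, so any two decompositions of this
  kind have the same fibers.\<close>

lemma fibers_of_hilbert_decomposition:
  fixes Y :: "'y metric" and H :: "'h metric"
  assumes D: "decomposition X Y H I" and Y: "\<nexists>l. splitting_line Y l" and H: "hilbert_space H"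
    and x: "x \<in> mspace X"
  shows "snd_fiber X I x = orbit x"
    and "fst_fiber X I x = {p \<in> mspace X. \<forall>v\<in>V. v p = v x}"
proof -
  show "snd_fiber X I x = orbit x"
  proof (rule equalityI[OF hilbert_fiber_subset_orbit[OF D H x]])
    show "orbit x \<subseteq> snd_fiber X I x"
    proof
      fix p assume "p \<in> orbit x"
      then obtain v where v: "v \<in> V" "p = trans v x" by (auto simp: orbit_def)
      then show "p \<in> snd_fiber X I x"
        using translation_of_hilbert_factor(1)[OF D Y H v(1) x] x by (simp add: snd_fiber_def)
    qed
  qed
  have "snd (I p) = snd (I x)" if p: "p \<in> mspace X" and eq: "\<forall>v\<in>V. v p = v x" for p
  proof -
    \<comment> \<open>The point \<open>r\<close> with these coordinates is a translate of
      \<open>x\<close> by some \<open>u\<close> from \<open>H\<close>. As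
      \<open>u r = u p = u x\<close>, the squared norm of \<open>u\<close> is zero, so
      \<open>r = x\<close>.\<close>
    have "(fst (I x), snd (I p)) \<in> I ` mspace X"
      using D imageI[OF x, of I] imageI[OF p, of I]
      by (simp add: decomposition_def isometry_def mem_Times_iff)
    then obtain r where r: "r \<in> mspace X" "I r = (fst (I x), snd (I p))" by (metis imageE)
    have "fst (I r) = fst (I x)" by (simp add: r)
    from hilbert_fiber_translation[OF D H x r(1) this] obtain u where u: "u \<in> V" "trans u x = r"
      and u_snd: "\<And>q r. \<lbrakk>q \<in> mspace X; r \<in> mspace X; snd (I q) = snd (I r)\<rbrakk> \<Longrightarrow> u q = u r" by blast
    have "u r = u p" by (rule u_snd[OF r(1) p]) (simp add: r)
    then have "ip u u = 0" using bspec[OF eq u(1)] u trans_height[OF u(1) u(1) x] by simp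
    then have "r = x" using ip_eq_zero[OF u(1)] u(2) x by simp
    then show ?thesis using arg_cong[OF r(2), of snd] by simp
  qed
  moreover have "v p = v x" if "v \<in> V" "p \<in> mspace X" "snd (I p) = snd (I x)" for v p
    by (rule translation_of_hilbert_factor(2)[OF D Y H that(1) x that(2) x that(3)])
  ultimately show "fst_fiber X I x = {p \<in> mspace X. \<forall>v\<in>V. v p = v x}"
    unfolding fst_fiber_def by blast
qed

lemma maximal_hilbert_factor_orbit:
  fixes Y :: "'y metric" and H :: "'h metric"
  assumes D: "decomposition X Y H I" and H: "hilbert_space H"
    and x: "x \<in> mspace X" and fiber: "snd_fiber X I x = orbit x"
  shows "is_maximal_hilbert_factor X x (snd_fiber X I x)"
  unfolding is_maximal_hilbert_factor_def
proof (intro conjI allI impI)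
  show "hilbert_factor X x (snd_fiber X I x)"
    using factor_subsetI[OF decomposition_swap[OF D] x] fst_fiber_isometry[OF decomposition_swap[OF D] x] H
    unfolding fst_fiber_swap by (intro hilbert_factorI) (auto simp: isometric_def)
next
  fix B assume "hilbert_factor X x B"
  then obtain Y' Z' :: "'a metric" and J and H' :: "'a metric" where J: "decomposition X Y' Z' J"
    and B: "B = fst_fiber X J x" and H': "hilbert_space H'" "isometric (submetric X B) H'"
    by (auto simp: hilbert_factor_def factor_subset_def)
  \<comment> \<open>The Hilbert structure is given on the fiber \<open>B\<close>; it is carried over
    to the factor \<open>Y'\<close>, and the factors are swapped to put the Hilbert space
    second.\<close>
  have "hilbert_space (submetric X B)" by (rule hilbert_space_isometric[OF H'(2,1)])
  moreover have "isometric Y' (submetric X B)"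
    using isometry_inv_into[OF fst_fiber_isometry[OF J x]] by (auto simp: isometric_def B)
  ultimately have "hilbert_space Y'" by (rule hilbert_space_isometric[rotated])
  from hilbert_fiber_subset_orbit[OF decomposition_swap[OF J] this x]
  show "B \<subseteq> snd_fiber X I x" by (simp add: B fiber snd_fiber_swap)
qed

end

section \<open>Existence and uniqueness of the decomposition\<close>

lemma hilbert_decomposition_nonempty:
  fixes X :: "'a metric"
  assumes X: "mcomplete_of X" and ne: "mspace X \<noteq> {}"
  obtains Y H :: "'a metric" and I :: "'a \<Rightarrow> 'a \<times> 'a"
  where "decomposition X Y H I" "\<nexists>l. splitting_line Y l" "hilbert_space H"
proof -
  obtain x0 where "x0 \<in> mspace X" using ne by blast
  then interpret pointed_metric_space X x0 by unfold_locales
  from decomposition_orbit[OF X] obtain I where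
    "decomposition X (submetric X {p \<in> mspace X. \<forall>v\<in>V. v p = 0}) (submetric X (orbit x0)) I"
    and "\<And>p. p \<in> mspace X \<Longrightarrow> \<forall>v\<in>V. v p = 0 \<Longrightarrow> fst (I p) = p" by blast
  with no_splitting_line_orthogonal[OF this] hilbert_space_orbit[OF X] show thesis
    by (intro that) auto
qed

text \<open>For empty \<open>X\<close> the theorem still asks for a Hilbert space over the element
  type. Decomposing a one-point space provides one.\<close>

lemma hilbert_space_exists: "\<exists>H :: 'a metric. hilbert_space H"
proof -
  define P where "P = (metric ({undefined}, \<lambda>_ _. 0) :: 'a metric)"
  have "Metric_space {undefined :: 'a} (\<lambda>_ _. 0)" by unfold_locales auto
  then have P: "mspace P = {undefined}" "mdist P = (\<lambda>_ _. 0)"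
    by (simp_all add: P_def Metric_space.mspace_metric Metric_space.mdist_metric)
  have "mcomplete_of P" by (rule mcomplete_ofI) (simp add: P)
  then show ?thesis by (rule hilbert_decomposition_nonempty) (auto simp: P)
qed

theorem theorem1p1:
  fixes X :: "'a metric"
  assumes "mcomplete_of X"
  shows "\<exists>(Y :: 'a metric) (H :: 'a metric) (I :: 'a \<Rightarrow> 'a \<times> 'a).
    decomposition X Y H I \<and> (\<nexists>l. splitting_line Y l) \<and> hilbert_space H \<and>
    (\<forall>(Y' :: 'b metric) (H' :: 'c metric) (I' :: 'a \<Rightarrow> 'b \<times> 'c).
       decomposition X Y' H' I' \<and> (\<nexists>l. splitting_line Y' l) \<and> hilbert_space H'
       \<longrightarrow> same_decomposition X I I') \<and>
    (\<forall>x\<in>mspace X.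
       is_maximal_hilbert_factor X x (snd_fiber X I x) \<and>
       snd_fiber X I x = insert x (\<Union>{l. splitting_line X l \<and> x \<in> l}))"
proof (cases "mspace X = {}")
  case True
  obtain H :: "'a metric" where H: "hilbert_space H" using hilbert_space_exists by blast
  \<comment> \<open>With the empty space as first factor the product is empty, whatever
    \<open>H\<close> and \<open>I\<close> are.\<close>
  have "decomposition X X H I" for I
    using True by (simp add: decomposition_def isometry_prod_iff)
  moreover have "\<not> splitting_line X l" for l
    using True by (auto simp: splitting_line_def line_in_def isometric_def isometry_def)
  ultimately show ?thesis
    using H True by (intro exI[of _ X] exI[of _ H] exI) (auto simp: same_decomposition_def)
next
  case False
  from hilbert_decomposition_nonempty[OF assms False]
  obtain Y H :: "'a metric" and I :: "'a \<Rightarrow> 'a \<times> 'a" where D: "decomposition X Y H I"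
    and Y: "\<nexists>l. splitting_line Y l" and H: "hilbert_space H" by blast
  obtain x0 where "x0 \<in> mspace X" using False by blast
  then interpret pointed_metric_space X x0 by unfold_locales
  have fib: "snd_fiber X I x = orbit x" "fst_fiber X I x = {p \<in> mspace X. \<forall>v\<in>V. v p = v x}"
    if "x \<in> mspace X" for x
    using fibers_of_hilbert_decomposition[OF D Y H that] .
  show ?thesis
  proof (rule exI[of _ Y], rule exI[of _ H], rule exI[of _ I], intro conjI allI impI ballI)
    fix Y' :: "'b metric" and H' :: "'c metric" and I' :: "'a \<Rightarrow> 'b \<times> 'c"
    assume "decomposition X Y' H' I' \<and> (\<nexists>l. splitting_line Y' l) \<and> hilbert_space H'"
    then have D': "decomposition X Y' H' I'" and Y': "\<nexists>l. splitting_line Y' l" and H': "hilbert_space H'"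
      by simp_all
    show "same_decomposition X I I'"
      using fibers_of_hilbert_decomposition[OF D' Y' H'] by (simp add: same_decomposition_def fib)
  next
    fix x assume x: "x \<in> mspace X"
    show "is_maximal_hilbert_factor X x (snd_fiber X I x)"
      by (rule maximal_hilbert_factor_orbit[OF D H x fib(1)[OF x]])
    show "snd_fiber X I x = insert x (\<Union>{l. splitting_line X l \<and> x \<in> l})"
      unfolding fib(1)[OF x] by (rule orbit_eq_splitting_lines[OF x])
  qed (rule D Y H)+
qed

end
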